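(* Let $G$ be a finite graph on $n$ vertices $\{x_1,\ldots,x_n\}$ (no loops, no multiple edges, no isolated vertices) and $\mathfrak{c}\in\mathbb{Z}_{>0}^n$. Suppose that $\delta_{\mathfrak{c}}(I(G))=2$. Then the toric ideal $J_{\mathcal{B}(G,\mathfrak{c})}$ of $\mathcal{B}(G,\mathfrak{c})$ is generated by symmetric exchange binomials.
   Context: Let $S=K[x_1,\ldots,x_n]$ over a field $K$ and let $I(G)$ be the edge ideal of $G$, generated by $x_ix_j$ for each edge $\{x_i,x_j\}$. For $q\geq1$ and $\mathfrak{c}=(c_1,\ldots,c_n)\in\mathbb{Z}_{>0}^n$, $(I(G)^q)_{\mathfrak{c}}$ denotes the monomial ideal generated by the monomials $x_1^{a_1}\cdots x_n^{a_n}\in I(G)^q$ with $a_i\leq c_i$ for all $i$; $\delta_{\mathfrak{c}}(I(G))$ is the largest $q$ with $(I(G)^q)_{\mathfrak{c}}\neq(0)$; and $\mathcal{B}(G,\mathfrak{c})$ is the minimal set of monomial generators of $(I(G)^{\delta_{\mathfrak{c}}(I(G))})_{\mathfrak{c}}$ (it is known to be a polymatroid). For a finite set of monomials $\mathcal{B}=\{w_1,\ldots,w_s\}$, let $T=K[z_1,\ldots,z_s]$ and $\pi:T\to K[w_1,\ldots,w_s]$ with $\pi(z_i)=w_i$; the toric ideal is $J_{\mathcal{B}}=\ker\pi$. A symmetric exchange binomial of $\mathcal{B}$ is a binomial $z_iz_j-z_{i_0}z_{j_0}$ where $w_i=x_1^{a_1}\cdots x_n^{a_n}$, $w_j=x_1^{b_1}\cdots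 x_n^{b_n}$, and there are indices $\xi,\rho$ with $a_\xi>b_\xi$, $a_\rho<b_\rho$ such that $w_{i_0}=x_\rho w_i/x_\xi$ and $w_{j_0}=x_\xi w_j/x_\rho$ both belong to $\mathcal{B}$. *)

theory Defs
  imports "HOL-Library.Poly_Mapping"
begin

text \<open>Polynomials over a field K in variables indexed by a type 'v are represented as
  maps from exponent vectors to coefficients: a monomial is its exponent vector, a polynomial maps
  exponent vectors to coefficients (finite support). The vertices x_1..x_n are the
  variables 0..n-1 (type nat).\<close>

type_synonym 'v monom = "'v \<Rightarrow>\<^sub>0 nat"
type_synonym ('v, 'k) mpoly = "('v monom) \<Rightarrow>\<^sub>0 'k"

definition poly_ring :: "'v set \<Rightarrow> ('v, 'k::zero) mpoly set" where
  "poly_ring V = {p :: ('v, 'k) mpoly. \<forall>m\<in>Poly_Mapping.keys p. Poly_Mapping.keys (m :: 'v monom) \<subseteq> V}"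

definition ideal_gen :: "'a::comm_ring_1 set \<Rightarrow> 'a set \<Rightarrow> 'a set" where
  "ideal_gen R S = {p. \<exists>F c. finite F \<and> F \<subseteq> S \<and> (\<forall>f\<in>F. c f \<in> R) \<and> p = (\<Sum>f\<in>F. c f * f)}"

definition ideal_pow :: "'a::comm_ring_1 set \<Rightarrow> 'a set \<Rightarrow> nat \<Rightarrow> 'a set" where
  "ideal_pow R I q = ideal_gen R {prod_list ps | ps. length ps = q \<and> set ps \<subseteq> I}"

definition mono :: "'v monom \<Rightarrow> ('v, 'k::{zero,one}) mpoly" where
  "mono a = Poly_Mapping.single a 1"

definition var_exp :: "'v \<Rightarrow> 'v monom" where
  "var_exp i = Poly_Mapping.single i 1"

definition simple_graph :: "nat \<Rightarrow> (nat \<Rightarrow> nat \<Rightarrow> bool) \<Rightarrow> bool" where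
  "simple_graph n E \<longleftrightarrow> (\<forall>i j. E i j \<longrightarrow> i < n \<and> j < n \<and> i \<noteq> j \<and> E j i)"

definition no_isolated :: "nat \<Rightarrow> (nat \<Rightarrow> nat \<Rightarrow> bool) \<Rightarrow> bool" where
  "no_isolated n E \<longleftrightarrow> (\<forall>i<n. \<exists>j. E i j)"

definition edge_ideal :: "nat \<Rightarrow> (nat \<Rightarrow> nat \<Rightarrow> bool) \<Rightarrow> (nat, 'k::field) mpoly set" where
  "edge_ideal n E = ideal_gen (poly_ring {0..<n})
     {mono (var_exp i + var_exp j) | i j. E i j}"

definition bounded_monos :: "'k::field itself \<Rightarrow> nat \<Rightarrow> (nat \<Rightarrow> nat \<Rightarrow> bool) \<Rightarrow> (nat \<Rightarrow> nat) \<Rightarrow> nat \<Rightarrow> nat monom set" where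
  "bounded_monos _ n E c q = {a. Poly_Mapping.keys a \<subseteq> {0..<n} \<and> (\<forall>i<n. Poly_Mapping.lookup a i \<le> c i) \<and>
     (mono a :: (nat, 'k) mpoly) \<in> ideal_pow (poly_ring {0..<n}) (edge_ideal n E) q}"

text \<open>(I(G)^q)_c is the ideal generated by bounded_monos; it is nonzero iff that set
  is nonempty. delta_c(I(G)) is the largest such q.\<close>
definition delta_c :: "'k::field itself \<Rightarrow> nat \<Rightarrow> (nat \<Rightarrow> nat \<Rightarrow> bool) \<Rightarrow> (nat \<Rightarrow> nat) \<Rightarrow> nat" where
  "delta_c K n E c = (GREATEST q. bounded_monos K n E c q \<noteq> {})"

definition mdvd :: "'v monom \<Rightarrow> 'v monom \<Rightarrow> bool" where
  "mdvd a b \<longleftrightarrow> (\<forall>i. Poly_Mapping.lookup a i \<le> Poly_Mapping.lookup b i)"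

text \<open>B(G,c): minimal monomial generators of (I(G)^delta)_c, i.e. the divisibility-minimal
  elements of the monomial generating set.\<close>
definition Bset :: "'k::field itself \<Rightarrow> nat \<Rightarrow> (nat \<Rightarrow> nat \<Rightarrow> bool) \<Rightarrow> (nat \<Rightarrow> nat) \<Rightarrow> nat monom set" where
  "Bset K n E c = (let M = bounded_monos K n E c (delta_c K n E c) in
     {a\<in>M. \<forall>b\<in>M. mdvd b a \<longrightarrow> b = a})"

text \<open>Toric ring map pi : T = K[z_w : w \<in> B] \<rightarrow> S, z_w \<mapsto> x^w, written out on a
  polynomial P = \<Sum> P_alpha z^alpha as \<Sum> P_alpha x^(\<Sum>_w alpha_w w).\<close>
definition toric_map :: "('v monom, 'k::comm_ring_1) mpoly \<Rightarrow> ('v, 'k) mpoly" where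
  "toric_map P = (\<Sum>\<alpha>\<in>Poly_Mapping.keys P. Poly_Mapping.single (\<Sum>w\<in>Poly_Mapping.keys \<alpha>. (\<Sum>j<Poly_Mapping.lookup \<alpha> w. w)) (Poly_Mapping.lookup P \<alpha>))"

definition toric_ideal :: "'v monom set \<Rightarrow> ('v monom, 'k::comm_ring_1) mpoly set" where
  "toric_ideal B = {P \<in> poly_ring B. toric_map P = 0}"

definition sym_exchange_binomials :: "'v monom set \<Rightarrow> ('v monom, 'k::comm_ring_1) mpoly set" where
  "sym_exchange_binomials B = {mono (var_exp u + var_exp v) - mono (var_exp u' + var_exp v') | u v u' v'.
     u \<in> B \<and> v \<in> B \<and> (\<exists>\<xi> \<rho>. Poly_Mapping.lookup u \<xi> > Poly_Mapping.lookup v \<xi> \<and> Poly_Mapping.lookup u \<rho> < Poly_Mapping.lookup v \<rho> \<and>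
        u' + var_exp \<xi> = u + var_exp \<rho> \<and> v' + var_exp \<rho> = v + var_exp \<xi> \<and>
        u' \<in> B \<and> v' \<in> B)}"

end

theory Submission
  imports Defs "HOL-Library.Multiset"
begin

text \<open>
  The elements of \<open>Bset\<close> are the degree vectors of the maximum \<open>c\<close>-bounded matchings, that is, of
  multisets of edges with degrees bounded by \<open>c\<close>. By maximality no alternating trail between two
  of them is augmenting, so the alternating trails pair the vertices where one degree vector
  exceeds the other with those where it falls short, and every set of these trails can be
  flipped by symmetric exchanges.

  Two monomials of \<open>T\<close> with the same image are multisets of bases with the same sum. Exchanges
  lower the sum of squares of the exponents until all entries of one multiset at a vertex differ
  by at most one. For such balanced multisets the argument of Lason and Michalek for strongly
  base orderable matroids applies: if bases \<open>u1, u2\<close> of the first multiset are matched with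
  \<open>v1, v2\<close> of the second, then the pairings for \<open>u1, u2\<close> and for \<open>v1, v2\<close> together form a
  bipartite graph, and flipping both pairs according to one 2-colouring brings them closer.
\<close>

section \<open>Alternating trails in bounded matchings\<close>

lemma lookup_var_exp: "Poly_Mapping.lookup (var_exp i) j = (if i = j then 1 else 0)"
  by (simp add: var_exp_def lookup_single when_def)

lemma lookup_sum_mset:
  "Poly_Mapping.lookup (sum_mset M) i = (\<Sum>m\<in>#M. Poly_Mapping.lookup m i)"
  by (induction M) (simp_all add: lookup_add)

lemma sum_mset_lookup_pos:
  fixes M :: "'v monom multiset"
  assumes "0 < Poly_Mapping.lookup (sum_mset M) i"
  obtains m where "m \<in># M" "0 < Poly_Mapping.lookup m i"
proof -
  have "(\<Sum>m\<in>#M. Poly_Mapping.lookup m i) \<noteq> 0"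
    using assms unfolding lookup_sum_mset by linarith
  then show thesis using that by (auto simp: sum_mset_0_iff)
qed

abbreviation deg_at :: "'v monom multiset \<Rightarrow> 'v \<Rightarrow> nat" where
  "deg_at M i \<equiv> Poly_Mapping.lookup (sum_mset M) i"

lemma deg_at_outside:
  assumes "\<forall>e\<in>#M. \<exists>i\<in>V. \<exists>j\<in>V. i \<noteq> j \<and> e = var_exp i + var_exp j" "i \<notin> V"
  shows "deg_at M i = 0"
  using assms by (induction M) (auto simp: lookup_add lookup_var_exp)

definition edge_monom :: "'v monom \<Rightarrow> bool" where
  "edge_monom e \<longleftrightarrow> (\<exists>i j. i \<noteq> j \<and> e = var_exp i + var_exp j)"

lemma edge_monom_at:
  assumes "edge_monom e" "0 < Poly_Mapping.lookup e i"
  obtains k where "k \<noteq> i" "e = var_exp i + var_exp k"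
proof -
  obtain a b where ab: "a \<noteq> b" "e = var_exp a + var_exp b"
    using assms(1) unfolding edge_monom_def by blast
  then have "i = a \<or> i = b" using assms(2)
    by (auto simp: lookup_add lookup_var_exp split: if_splits)
  then show thesis using ab that by (metis add.commute)
qed

text \<open>An alternating trail in the multigraph \<open>M1 + M2\<close> that starts at \<open>i\<close> with an edge
  of \<open>M1\<close> is extended until it stops at a vertex where \<open>M1\<close> and \<open>M2\<close> are unbalanced; \<open>X\<close> and
  \<open>Y\<close> are its edges in \<open>M1\<close> and \<open>M2\<close>, and the second alternative is an augmenting trail.\<close>
lemma alternating_trail:
  assumes "\<forall>e\<in>#M1 + M2. edge_monom e" "deg_at M2 i < deg_at M1 i"
  shows "\<exists>X Y j. X \<subseteq># M1 \<and> Y \<subseteq># M2 \<and>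
    (size X = size Y \<and> sum_mset X + var_exp j = sum_mset Y + var_exp i \<and>
       deg_at M1 j < deg_at M2 j \<or>
     size X = Suc (size Y) \<and> sum_mset X = sum_mset Y + var_exp i + var_exp j \<and>
       deg_at M2 j + (if i = j then 1 else 0) < deg_at M1 j)"
  using assms
proof (induction "size M1 + size M2" arbitrary: M1 M2 i rule: less_induct)
  case less
  obtain e where e: "e \<in># M1" "0 < Poly_Mapping.lookup e i"
    using sum_mset_lookup_pos[of M1 i] less.prems(2) by (metis gr_zeroI not_less0)
  obtain k where k: "k \<noteq> i" "e = var_exp i + var_exp k"
    using edge_monom_at e less.prems(1) by (metis union_iff)
  obtain M where M: "M1 = add_mset e M" using e(1) by (metis mset_add)
  have deg: "deg_at M1 l = deg_at M l + (if i = l then 1 else 0) + (if k = l then 1 else 0)" for l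
    by (simp add: M k lookup_add lookup_var_exp)
  show ?case
  \<comment> \<open>If \<open>M1\<close> still has a surplus at \<open>k\<close>, the single edge
    \<open>e\<close> is already an augmenting trail from \<open>i\<close> to
    \<open>k\<close>.\<close>
  proof (cases "deg_at M2 k < deg_at M1 k")
    case True
    then have "{#e#} \<subseteq># M1 \<and> {#} \<subseteq># M2 \<and> size {#e#} = Suc (size {#}) \<and>
      sum_mset {#e#} = sum_mset {#} + var_exp i + var_exp k \<and>
      deg_at M2 k + (if i = k then 1 else 0) < deg_at M1 k"
      using e(1) k by simp
    then show ?thesis by blast
  next
    case False
    \<comment> \<open>Otherwise the trail must continue from \<open>k\<close> with an edge of
      \<open>M2\<close>. Removing \<open>e\<close> leaves \<open>M2\<close> with a surplus over
      \<open>M\<close> at \<open>k\<close>, so the induction hypothesis applies with the two roles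
      exchanged.\<close>
    have "\<forall>e\<in>#M2 + M. edge_monom e" "deg_at M k < deg_at M2 k" "size M2 + size M < size M1 + size M2"
      using less.prems(1) False deg[of k] k(1) by (auto simp: M)
    from less.hyps[OF this(3,1,2)] obtain Y X j where XY: "Y \<subseteq># M2" "X \<subseteq># M"
      "size Y = size X \<and> sum_mset Y + var_exp j = sum_mset X + var_exp k \<and>
         deg_at M2 j < deg_at M j \<or>
       size Y = Suc (size X) \<and> sum_mset Y = sum_mset X + var_exp k + var_exp j \<and>
         deg_at M j + (if k = j then 1 else 0) < deg_at M2 j"
      by blast
    have sub: "add_mset e X \<subseteq># M1" using XY(2) M by simp
    from XY(3) show ?thesis
    proof
      assume h: "size Y = size X \<and> sum_mset Y + var_exp j = sum_mset X + var_exp k \<and>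
         deg_at M2 j < deg_at M j"
      have "size (add_mset e X) = Suc (size Y)" using h by simp
      moreover have "sum_mset (add_mset e X) = sum_mset Y + var_exp i + var_exp j"
        using h by (simp add: k ac_simps)
      moreover have "deg_at M2 j + (if i = j then 1 else 0) < deg_at M1 j"
        using h deg[of j] by auto
      ultimately show ?thesis using sub XY(1) by blast
    next
      assume h: "size Y = Suc (size X) \<and> sum_mset Y = sum_mset X + var_exp k + var_exp j \<and>
         deg_at M j + (if k = j then 1 else 0) < deg_at M2 j"
      have "size (add_mset e X) = size Y" using h by simp
      moreover have "sum_mset (add_mset e X) + var_exp j = sum_mset Y + var_exp i"
        using h by (simp add: k ac_simps)
      \<comment> \<open>An end at \<open>i\<close> would mean that \<open>M2\<close> exceeds
        \<open>M\<close> there. Putting \<open>e\<close> back raises the degree at \<open>i\<close>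
        by one only, so \<open>M2\<close> would have at least the degree of \<open>M1\<close> at
        \<open>i\<close>.\<close>
      moreover have "i \<noteq> j" using h less.prems(2) deg[of j] by auto
      then have "deg_at M1 j < deg_at M2 j"
        using h deg[of j] by (auto split: if_splits)
      ultimately show ?thesis using sub XY(1) by blast
    qed
  qed
qed

text \<open>Matchings are multisets, so an edge may be repeated. Excluding size \<open>Suc q\<close>
  excludes every larger size, since degree bounds pass to submultisets.\<close>

locale bounded_matchings =
  fixes V :: "'v set" and Eg :: "'v monom set" and c :: "'v \<Rightarrow> nat" and q :: nat
  assumes finite_V: "finite V"
    and edges: "e \<in> Eg \<Longrightarrow> \<exists>i\<in>V. \<exists>j\<in>V. i \<noteq> j \<and> e = var_exp i + var_exp j"
    and maximal: "set_mset M \<subseteq> Eg \<Longrightarrow> size M = Suc q \<Longrightarrow> \<exists>i. c i < deg_at M i"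
begin

definition matchings :: "'v monom multiset set" where
  "matchings = {M. set_mset M \<subseteq> Eg \<and> size M = q \<and> (\<forall>i. deg_at M i \<le> c i)}"

definition bases :: "'v monom set" where
  "bases = sum_mset ` matchings"

lemma edge_monom: "e \<in> Eg \<Longrightarrow> edge_monom e"
  using edges unfolding edge_monom_def by blast

text \<open>An augmenting trail would enlarge \<open>M2\<close>: replacing \<open>Y\<close> by
  \<open>X\<close> gives \<open>Suc q\<close> edges and raises degrees only at the ends
  \<open>i\<close> and \<open>j\<close>. By \<open>excess\<close>, the surplus of \<open>N1\<close>
  over \<open>N2\<close> at those ends is at most that of \<open>M1\<close> over \<open>M2\<close>,
  so the new degrees are bounded by those of \<open>M1\<close>, against maximality. The submultisets
  \<open>N1\<close> and \<open>N2\<close> are what remains after some trails have been taken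
  out.\<close>

lemma exchange_path:
  assumes M: "M1 \<in> matchings" "M2 \<in> matchings" and N: "N1 \<subseteq># M1" "N2 \<subseteq># M2"
    and excess: "\<And>j. deg_at N1 j \<le> deg_at N2 j \<or>
      deg_at N1 j + deg_at M2 j \<le> deg_at N2 j + deg_at M1 j"
    and i: "deg_at N2 i < deg_at N1 i"
  obtains X Y j where "X \<subseteq># N1" "Y \<subseteq># N2" "size X = size Y"
    "sum_mset X + var_exp j = sum_mset Y + var_exp i" "deg_at N1 j < deg_at N2 j"
proof -
  have ME: "set_mset M1 \<subseteq> Eg" "set_mset M2 \<subseteq> Eg" and sz: "size M2 = q"
    and bd: "\<And>l. deg_at M1 l \<le> c l" "\<And>l. deg_at M2 l \<le> c l"
    using M by (auto simp: matchings_def)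
  have NE: "\<forall>e\<in>#N1 + N2. edge_monom e"
    using ME N edge_monom by (auto dest!: set_mset_mono)
  from alternating_trail[OF this i] obtain X Y j where XY: "X \<subseteq># N1" "Y \<subseteq># N2"
    "size X = size Y \<and> sum_mset X + var_exp j = sum_mset Y + var_exp i \<and>
       deg_at N1 j < deg_at N2 j \<or>
     size X = Suc (size Y) \<and> sum_mset X = sum_mset Y + var_exp i + var_exp j \<and>
       deg_at N2 j + (if i = j then 1 else 0) < deg_at N1 j"
    by blast
  from XY(3) show thesis
  proof
    assume "size X = size Y \<and> sum_mset X + var_exp j = sum_mset Y + var_exp i \<and>
       deg_at N1 j < deg_at N2 j"
    then show thesis using that XY(1,2) by blast
  next
    assume h: "size X = Suc (size Y) \<and> sum_mset X = sum_mset Y + var_exp i + var_exp j \<and>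
       deg_at N2 j + (if i = j then 1 else 0) < deg_at N1 j"
    obtain R where R: "M2 = Y + R" using XY(2) N(2) by (meson mset_subset_eq_exists_conv subset_mset.trans)
    have X1: "set_mset X \<subseteq> Eg" using XY(1) N(1) ME by (meson set_mset_mono subset_trans)
    have "set_mset (X + R) \<subseteq> Eg" "size (X + R) = Suc q"
      using X1 ME sz h R by auto
    from maximal[OF this] obtain l where l: "c l < deg_at (X + R) l" by blast
    have "deg_at (X + R) l = deg_at M2 l + (if i = l then 1 else 0) + (if j = l then 1 else 0)"
      using h by (simp add: R lookup_add lookup_var_exp)
    then show thesis using l bd[of l] excess[of l] h i
      by (auto split: if_splits)
  qed
qed

text \<open>One trail is swapped between the two full matchings, where the condition
  \<open>excess\<close> is trivial. Degrees change only at its ends, and there they stay between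
  those of \<open>u\<close> and \<open>v\<close>, hence below \<open>c\<close>.\<close>

lemma symmetric_exchange:
  assumes "u \<in> bases" "v \<in> bases" "Poly_Mapping.lookup v i < Poly_Mapping.lookup u i"
  obtains j u' v' where "Poly_Mapping.lookup u j < Poly_Mapping.lookup v j"
    "u' \<in> bases" "v' \<in> bases" "u' + var_exp i = u + var_exp j" "v' + var_exp j = v + var_exp i"
proof -
  obtain M1 M2 where M: "M1 \<in> matchings" "M2 \<in> matchings" "u = sum_mset M1" "v = sum_mset M2"
    using assms(1,2) unfolding bases_def by blast
  obtain X Y j where XY: "X \<subseteq># M1" "Y \<subseteq># M2" "size X = size Y"
    "sum_mset X + var_exp j = sum_mset Y + var_exp i" "deg_at M1 j < deg_at M2 j"
    using exchange_path[OF M(1,2), of M1 M2 i] assms(3) M(3,4) by auto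
  obtain R1 R2 where R: "M1 = X + R1" "M2 = Y + R2"
    using XY(1,2) by (meson mset_subset_eq_exists_conv)
  define M1' M2' where "M1' = Y + R1" and "M2' = X + R2"
  have e1: "sum_mset M1' + var_exp i = u + var_exp j"
  proof -
    have "sum_mset M1' + var_exp i = sum_mset R1 + (sum_mset Y + var_exp i)"
      by (simp add: M1'_def ac_simps)
    also have "\<dots> = sum_mset R1 + (sum_mset X + var_exp j)" by (simp only: XY(4))
    finally show ?thesis by (simp add: M R ac_simps)
  qed
  have e2: "sum_mset M2' + var_exp j = v + var_exp i"
  proof -
    have "sum_mset M2' + var_exp j = sum_mset R2 + (sum_mset X + var_exp j)"
      by (simp add: M2'_def ac_simps)
    also have "\<dots> = sum_mset R2 + (sum_mset Y + var_exp i)" by (simp only: XY(4))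
    finally show ?thesis by (simp add: M R ac_simps)
  qed
  have b: "\<And>l. deg_at M1 l \<le> c l" "\<And>l. deg_at M2 l \<le> c l"
    using M by (auto simp: matchings_def)
  have "deg_at M1' l \<le> c l" for l
    using arg_cong[OF e1, of "\<lambda>p. Poly_Mapping.lookup p l"] b[of l] XY(5) M(3)
    by (auto simp: lookup_add lookup_var_exp split: if_splits)
  then have "M1' \<in> matchings"
    using M(1,2) XY(3) by (auto simp: matchings_def R M1'_def)
  have "deg_at M2' l \<le> c l" for l
    using arg_cong[OF e2, of "\<lambda>p. Poly_Mapping.lookup p l"] b[of l] assms(3) M(3,4)
    by (auto simp: lookup_add lookup_var_exp split: if_splits)
  then have "M2' \<in> matchings"
    using M(1,2) XY(3) by (auto simp: matchings_def R M2'_def)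
  show thesis
    using that[of j "sum_mset M1'" "sum_mset M2'"] e1 e2 XY(5) M \<open>M1' \<in> matchings\<close> \<open>M2' \<in> matchings\<close>
    by (auto simp: bases_def)
qed

end

section \<open>Symmetric exchanges\<close>

definition sym_exchange :: "'v monom set \<Rightarrow> 'v monom \<Rightarrow> 'v monom \<Rightarrow> 'v monom \<Rightarrow> 'v monom \<Rightarrow> bool" where
  "sym_exchange B u v u' v' \<longleftrightarrow> u \<in> B \<and> v \<in> B \<and> u' \<in> B \<and> v' \<in> B \<and>
     (\<exists>\<xi> \<rho>. Poly_Mapping.lookup u \<xi> > Poly_Mapping.lookup v \<xi> \<and>
        Poly_Mapping.lookup u \<rho> < Poly_Mapping.lookup v \<rho> \<and>
        u' + var_exp \<xi> = u + var_exp \<rho> \<and> v' + var_exp \<rho> = v + var_exp \<xi>)"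

text \<open>A multiset over \<open>B\<close> encodes a monomial of the toric polynomial ring,
  multiplicities being exponents. The relation corresponds to congruence modulo the symmetric
  exchange binomials.\<close>

inductive exchange_equiv :: "'v monom set \<Rightarrow> 'v monom multiset \<Rightarrow> 'v monom multiset \<Rightarrow> bool"
  for B where
  refl: "exchange_equiv B M M"
| step: "set_mset M \<subseteq> B \<Longrightarrow> sym_exchange B u v u' v' \<Longrightarrow>
    exchange_equiv B (M + {#u, v#}) (M + {#u', v'#})"
| sym: "exchange_equiv B M N \<Longrightarrow> exchange_equiv B N M"
| trans: "exchange_equiv B L M \<Longrightarrow> exchange_equiv B M N \<Longrightarrow> exchange_equiv B L N"

lemma exchange_equiv_add:
  assumes "exchange_equiv B M N" "set_mset L \<subseteq> B"
  shows "exchange_equiv B (L + M) (L + N)"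
  using assms(1)
proof induction
  case (step M u v u' v')
  then show ?case
    using exchange_equiv.step[of "L + M" B u v u' v'] assms(2) by (simp add: ac_simps)
qed (auto intro: exchange_equiv.intros)

text \<open>By injectivity the sum is the indicator of the image of \<open>K\<close>; this evaluates
  the effect of flipping a set of pairs vertex by vertex.\<close>

lemma sum_var_exp_at:
  assumes "finite P" "inj_on h P" "K \<subseteq> P"
  shows "Poly_Mapping.lookup (\<Sum>p\<in>K. var_exp (h p)) i = (if i \<in> h ` K then 1 else 0)"
proof -
  have K: "finite K" "inj_on h K"
    using assms finite_subset inj_on_subset by blast+
  have "(\<Sum>p\<in>K. if h p = i then 1 else (0::nat)) = (\<Sum>j\<in>h ` K. if j = i then 1 else 0)"
    using sum.reindex[OF K(2), of "\<lambda>j. if j = i then 1 else (0::nat)"] by simp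
  then show ?thesis
    using K(1) by (simp add: lookup_sum lookup_var_exp)
qed

text \<open>By induction on \<open>P\<close>: a pair \<open>{a, b}\<close> of \<open>P\<close> whose ends have partners \<open>a'\<close> and \<open>b'\<close> in \<open>Q\<close>
  is contracted, the pair \<open>{a', b'}\<close> of \<open>Q\<close> replacing the path from \<open>a'\<close> to \<open>b'\<close>.\<close>
lemma two_matchings_colouring:
  fixes P Q :: "('a \<times> 'a) set"
  assumes "finite P" "finite Q"
    and P: "inj_on fst P" "inj_on snd P" "fst ` P \<inter> snd ` P = {}"
    and Q: "inj_on fst Q" "inj_on snd Q" "fst ` Q \<inter> snd ` Q = {}"
  obtains f :: "'a \<Rightarrow> bool" where "\<forall>(a, b)\<in>P \<union> Q. f a \<noteq> f b"
proof -
  \<comment> \<open>The pairs become two-element sets because contraction loses the orientation: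
    \<open>a'\<close> and \<open>b'\<close> may both be first components, or both second
    ones.\<close>
  define matching where "matching (R::'a set set) \<longleftrightarrow> finite R \<and> (\<forall>e\<in>R. card e = 2) \<and>
    (\<forall>e\<in>R. \<forall>e'\<in>R. e \<inter> e' \<noteq> {} \<longrightarrow> e = e')" for R
  have mk: "matching ((\<lambda>(a, b). {a, b}) ` R)" if "finite R" "inj_on fst R" "inj_on snd R"
    "fst ` R \<inter> snd ` R = {}" for R :: "('a \<times> 'a) set"
    unfolding matching_def
  proof (intro conjI ballI impI)
    show "finite ((\<lambda>(a, b). {a, b}) ` R)" using that by simp
  next
    fix e assume "e \<in> (\<lambda>(a, b). {a, b}) ` R"
    then obtain a b where ab: "(a, b) \<in> R" "e = {a, b}" by auto
    have "a \<in> fst ` R" "b \<in> snd ` R" using ab(1) by (auto simp: rev_image_eqI)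
    then have "a \<noteq> b" using that(4) by blast
    then show "card e = 2" using ab by simp
  next
    fix e e' assume "e \<in> (\<lambda>(a, b). {a, b}) ` R" "e' \<in> (\<lambda>(a, b). {a, b}) ` R" and ne: "e \<inter> e' \<noteq> {}"
    then obtain a b a' b' where ab: "(a, b) \<in> R" "e = {a, b}" "(a', b') \<in> R" "e' = {a', b'}"
      by auto
    have "a \<in> fst ` R" "b \<in> snd ` R" "a' \<in> fst ` R" "b' \<in> snd ` R"
      using ab by (auto simp: rev_image_eqI)
    then have "a \<noteq> b'" "b \<noteq> a'" using that(4) by blast+
    then have "a = a' \<or> b = b'" using ne ab by auto
    then show "e = e'"
      using ab inj_onD[OF that(2), of "(a, b)" "(a', b')"] inj_onD[OF that(3), of "(a, b)" "(a', b')"]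
      by auto
  qed
  define proper where "proper f R \<longleftrightarrow> (\<forall>e\<in>R. \<forall>a b. e = {a, b} \<longrightarrow> f a \<noteq> (f b :: bool))" for f :: "'a \<Rightarrow> bool" and R
  have main: "\<exists>f. proper f (S \<union> T)" if "matching S" "matching T" for S T
    using that
  proof (induction "card S" arbitrary: S T)
    case 0
    then have "S = {}" by (simp add: matching_def)
    \<comment> \<open>With \<open>S\<close> empty, marking one chosen element of each member of
      \<open>T\<close> is a proper colouring, since disjointness leaves the other element
      unmarked.\<close>
    have "\<forall>e\<in>T. \<exists>a. a \<in> e" using 0(3) unfolding matching_def by (metis card.empty ex_in_conv zero_neq_numeral)
    then obtain r where r: "\<And>e. e \<in> T \<Longrightarrow> r e \<in> e" by metis
    have "proper (\<lambda>a. a \<in> r ` T) T"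
      unfolding proper_def
    proof (intro ballI allI impI)
      fix e a b assume e: "e \<in> T" "e = {a, b}"
      have uniq: "x = r e" if x: "x \<in> e" "x \<in> r ` T" for x
      proof -
        obtain e' where e': "e' \<in> T" "x = r e'" using x(2) by blast
        then have "x \<in> e \<inter> e'" using r x(1) by blast
        then have "e = e'" using 0(3) e(1) e'(1) unfolding matching_def by blast
        then show ?thesis using e' by simp
      qed
      have "a \<noteq> b" using 0(3) e unfolding matching_def by fastforce
      moreover have "r e = a \<or> r e = b" using r[OF e(1)] e(2) by blast
      moreover have "r e \<in> r ` T" using e(1) by blast
      moreover have "a \<in> r ` T \<longrightarrow> a = r e" "b \<in> r ` T \<longrightarrow> b = r e" using uniq e(2) by blast+
      ultimately show "(a \<in> r ` T) \<noteq> (b \<in> r ` T)" by metis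
    qed
    then show ?case using \<open>S = {}\<close> by auto
  next
    case (Suc n)
    then obtain s where "s \<in> S" by (metis card.empty ex_in_conv nat.simps(3))
    define S' where "S' = S - {s}"
    have cS': "n = card S'" using Suc.hyps(2) \<open>s \<in> S\<close> Suc.prems unfolding S'_def matching_def by simp
    have mS': "matching S'" using Suc.prems(1) unfolding S'_def matching_def by blast
    obtain a b where ab: "s = {a, b}" "a \<noteq> b"
      using Suc.prems(1) \<open>s \<in> S\<close> unfolding matching_def by (metis card_2_iff)
    have S_ab: "a \<notin> e \<and> b \<notin> e" if "e \<in> S'" for e
    proof -
      have "e \<in> S" "e \<noteq> s" using that unfolding S'_def by auto
      then have "e \<inter> s = {}" using Suc.prems(1) \<open>s \<in> S\<close> unfolding matching_def by metis
      then show ?thesis using ab(1) by auto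
    qed
    have S: "S = insert s S'" using \<open>s \<in> S\<close> S'_def by blast
    have pS: "proper f {s} \<longleftrightarrow> f a \<noteq> f b" for f
      unfolding proper_def ab by (auto simp: doubleton_eq_iff)
    have pun: "proper f (X \<union> Y) \<longleftrightarrow> proper f X \<and> proper f Y" for f X Y
      unfolding proper_def by blast
    have upd: "proper (f(x := z)) X" if "proper f X" "\<And>e. e \<in> X \<Longrightarrow> x \<notin> e" for f x z X
      using that unfolding proper_def by auto
    \<comment> \<open>If an end \<open>x\<close> of \<open>s\<close> is covered by no member of
      \<open>T\<close>, then \<open>s\<close> is the only pair through \<open>x\<close>. The rest is
      coloured first and \<open>x\<close> afterwards, opposite to \<open>y\<close>.\<close>
    have free: ?case if x: "{x, y} = {a, b}" and xT: "\<And>e. e \<in> T \<Longrightarrow> x \<notin> e" for x y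
    proof -
      obtain f where f: "proper f (S' \<union> T)" using Suc.hyps(1)[OF cS' mS' Suc.prems(2)] by blast
      have "proper (f(x := \<not> f y)) (S' \<union> T)"
        using f by (rule upd) (use S_ab x xT in \<open>auto simp: doubleton_eq_iff\<close>)
      moreover have "proper (f(x := \<not> f y)) {s}"
        unfolding pS using x ab by (auto simp: doubleton_eq_iff)
      ultimately show ?thesis
        unfolding S using pun[of _ "{s}" "S' \<union> T"] by auto
    qed
    show ?case
    proof (cases "(\<exists>e\<in>T. a \<in> e) \<and> (\<exists>e\<in>T. b \<in> e)")
      case False
      then show ?thesis using free[of a b] free[of b a] by blast
    next
      case True
      then obtain ea eb where e: "ea \<in> T" "a \<in> ea" "eb \<in> T" "b \<in> eb" by blast
      have uT: "e' = e''" if "e' \<in> T" "e'' \<in> T" "x \<in> e'" "x \<in> e''" for e' e'' x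
        using Suc.prems(2) that unfolding matching_def by blast
      have cT: "card e' = 2" if "e' \<in> T" for e' using Suc.prems(2) that unfolding matching_def by blast
      have fT: "finite T" using Suc.prems(2) unfolding matching_def by blast
      show ?thesis
      proof (cases "ea = eb")
        \<comment> \<open>Here \<open>s\<close> itself belongs to \<open>T\<close>, so dropping it
          from \<open>S\<close> does not change the union.\<close>
        case True
        then have "ea = s" using cT[OF e(1)] e ab by (auto simp: card_2_iff)
        obtain f where f: "proper f (S' \<union> T)" using Suc.hyps(1)[OF cS' mS' Suc.prems(2)] by blast
        then have "proper f (S \<union> T)" using S \<open>ea = s\<close> e(1) by (metis Un_insert_left insert_absorb UnCI)
        then show ?thesis by blast
      next
        case False
        obtain a' where a': "ea = {a, a'}" "a \<noteq> a'" using cT[OF e(1)] e(2) by (auto simp: card_2_iff)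
        obtain b' where b': "eb = {b, b'}" "b \<noteq> b'" using cT[OF e(3)] e(4) by (auto simp: card_2_iff)
        have ne: "a' \<noteq> b'" "a' \<noteq> b" "b' \<noteq> a"
          using uT[OF e(1,3)] False a' b' by auto
        define T0 where "T0 = T - {ea, eb}"
        have T: "T = insert ea (insert eb T0)" using e unfolding T0_def by blast
        have T0: "e' \<in> T \<and> a \<notin> e' \<and> b \<notin> e' \<and> a' \<notin> e' \<and> b' \<notin> e'" if "e' \<in> T0" for e'
        proof -
          have e': "e' \<in> T" "e' \<noteq> ea" "e' \<noteq> eb" using that unfolding T0_def by auto
          then have "e' \<inter> ea = {}" "e' \<inter> eb = {}" using uT[OF e'(1) e(1)] uT[OF e'(1) e(3)] by blast+
          then show ?thesis using e'(1) a'(1) b'(1) by auto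
        qed
        have "matching (insert {a', b'} T0)"
          using Suc.prems(2) T0 fT ne(1) unfolding matching_def T by auto
        from Suc.hyps(1)[OF cS' mS' this] obtain f where f: "proper f (S' \<union> insert {a', b'} T0)"
          by blast
        \<comment> \<open>The new pair forces \<open>f a'\<close> and \<open>f b'\<close> to differ.
          The opposite colours given to \<open>a\<close> and \<open>b\<close> then differ as well,
          so all three pairs on the path \<open>a'\<close>, \<open>a\<close>, \<open>b\<close>,
          \<open>b'\<close> are properly coloured.\<close>
        define g where "g = f(a := \<not> f a', b := \<not> f b')"
        have "f a' \<noteq> f b'" using f unfolding proper_def by blast
        then have 1: "proper g {s}" unfolding pS g_def using ab(2) by auto
        have "proper f (S' \<union> T0)" using f unfolding proper_def by blast
        then have 2: "proper g (S' \<union> T0)" unfolding g_def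
          by (intro upd) (use S_ab T0 in auto)
        have 3: "proper g {ea, eb}"
          unfolding proper_def g_def a' b' using ab(2) ne a'(2) b'(2) by (auto simp: doubleton_eq_iff)
        have "S \<union> T = {s} \<union> ((S' \<union> T0) \<union> {ea, eb})" using S T by auto
        then show ?thesis using 1 2 3 pun by metis
      qed
    qed
  qed
  from main[OF mk[OF assms(1) P] mk[OF assms(2) Q]]
  obtain f where f: "proper f ((\<lambda>(a, b). {a, b}) ` P \<union> (\<lambda>(a, b). {a, b}) ` Q)" by blast
  have "\<forall>(a, b)\<in>P \<union> Q. f a \<noteq> f b"
    using f unfolding proper_def image_Un[symmetric] by force
  then show thesis using that by blast
qed

section \<open>Simultaneous exchanges between balanced bases\<close>

context bounded_matchings
begin

definition balanced :: "'v monom \<Rightarrow> 'v monom \<Rightarrow> bool" where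
  "balanced u v \<longleftrightarrow> (\<forall>i. Poly_Mapping.lookup u i \<le> Suc (Poly_Mapping.lookup v i) \<and>
     Poly_Mapping.lookup v i \<le> Suc (Poly_Mapping.lookup u i))"

text \<open>The graph of a bijection from surplus to deficit vertices, kept as a set of pairs so
  that any subset of it can be selected for flipping.\<close>

definition pairing :: "'v monom \<Rightarrow> 'v monom \<Rightarrow> ('v \<times> 'v) set \<Rightarrow> bool" where
  "pairing u v P \<longleftrightarrow> finite P \<and> inj_on fst P \<and> inj_on snd P \<and>
     fst ` P = {i. Poly_Mapping.lookup v i < Poly_Mapping.lookup u i} \<and>
     snd ` P = {i. Poly_Mapping.lookup u i < Poly_Mapping.lookup v i}"

text \<open>Trails are peeled off one at a time. By balance the surplus at \<open>i\<close> and the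
  deficit at \<open>j\<close> are exactly one, so deleting \<open>X\<close> and \<open>Y\<close>
  removes these two and changes no other difference. The remaining trails use other edges and can be
  flipped independently. Condition \<open>D\<close>, with balance, supplies the hypothesis
  \<open>excess\<close> of \<open>exchange_path\<close> at every stage.\<close>

lemma flippable_pairing_aux:
  assumes M: "M1 \<in> matchings" "M2 \<in> matchings" "balanced (sum_mset M1) (sum_mset M2)"
    and N: "N1 \<subseteq># M1" "N2 \<subseteq># M2" "size N1 = size N2" "balanced (sum_mset N1) (sum_mset N2)"
    and D: "\<And>i. deg_at N2 i < deg_at N1 i \<Longrightarrow> deg_at M2 i < deg_at M1 i"
      "\<And>i. deg_at N1 i < deg_at N2 i \<Longrightarrow> deg_at M1 i < deg_at M2 i"
  shows "\<exists>P. pairing (sum_mset N1) (sum_mset N2) P \<and>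
    (\<forall>K\<subseteq>P. (\<exists>N. set_mset N \<subseteq> Eg \<and> size N = size N1 \<and>
          sum_mset N + (\<Sum>p\<in>K. var_exp (fst p)) = sum_mset N1 + (\<Sum>p\<in>K. var_exp (snd p))) \<and>
        (\<exists>N. set_mset N \<subseteq> Eg \<and> size N = size N2 \<and>
          sum_mset N + (\<Sum>p\<in>K. var_exp (snd p)) = sum_mset N2 + (\<Sum>p\<in>K. var_exp (fst p))))"
  using N D
proof (induction "size N1" arbitrary: N1 N2 rule: less_induct)
  case less
  have NE: "set_mset N1 \<subseteq> Eg" "set_mset N2 \<subseteq> Eg"
    using M less.prems(1,2) by (auto simp: matchings_def dest!: set_mset_mono)
  have bal: "deg_at N1 i \<le> Suc (deg_at N2 i)" "deg_at N2 i \<le> Suc (deg_at N1 i)"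
    "deg_at M1 i \<le> Suc (deg_at M2 i)" "deg_at M2 i \<le> Suc (deg_at M1 i)" for i
    using less.prems(4) M(3) unfolding balanced_def by auto
  have ex1: "deg_at N1 j \<le> deg_at N2 j \<or> deg_at N1 j + deg_at M2 j \<le> deg_at N2 j + deg_at M1 j" for j
    using less.prems(5)[of j] bal[of j] by linarith
  have ex2: "deg_at N2 j \<le> deg_at N1 j \<or> deg_at N2 j + deg_at M1 j \<le> deg_at N1 j + deg_at M2 j" for j
    using less.prems(6)[of j] bal[of j] by linarith
  show ?case
  proof (cases "\<exists>i. deg_at N2 i < deg_at N1 i")
    case False
    \<comment> \<open>Without surplus there is no deficit either: a trail starting at a deficit,
      with the roles exchanged, would end at a surplus.\<close>
    have "\<not> deg_at N1 i < deg_at N2 i" for i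
    proof
      assume "deg_at N1 i < deg_at N2 i"
      then show False
        using exchange_path[OF M(2,1) less.prems(2,1) ex2, of i] False by blast
    qed
    then have "pairing (sum_mset N1) (sum_mset N2) {}"
      using False unfolding pairing_def by simp
    then show ?thesis using NE by (intro exI[of _ "{}"]) auto
  next
    case True
    then obtain i where i: "deg_at N2 i < deg_at N1 i" by blast
    obtain X Y j where XY: "X \<subseteq># N1" "Y \<subseteq># N2" "size X = size Y"
      "sum_mset X + var_exp j = sum_mset Y + var_exp i" "deg_at N1 j < deg_at N2 j"
      using exchange_path[OF M(1,2) less.prems(1,2) ex1 i] by blast
    have ij: "i \<noteq> j" using i XY(5) by auto
    define R1 R2 where "R1 = N1 - X" and "R2 = N2 - Y"
    have R: "N1 = X + R1" "N2 = Y + R2" using XY(1,2) by (simp_all add: R1_def R2_def)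
    have "X \<noteq> {#}"
    proof
      assume "X = {#}"
      then have "var_exp j = var_exp i" using XY(3,4) by simp
      then have "Poly_Mapping.lookup (var_exp j) i = Poly_Mapping.lookup (var_exp i) i" by simp
      then show False using ij by (simp add: lookup_var_exp)
    qed
    then have small: "size R1 < size N1" by (simp add: R nonempty_has_size)
    have XYat: "deg_at X l + (if j = l then 1 else 0) = deg_at Y l + (if i = l then 1 else 0)" for l
      using arg_cong[OF XY(4), of "\<lambda>p. Poly_Mapping.lookup p l"]
      by (simp add: lookup_add lookup_var_exp)
    have at: "deg_at N1 l = deg_at X l + deg_at R1 l" "deg_at N2 l = deg_at Y l + deg_at R2 l" for l
      by (simp_all add: R lookup_add)
    have diff: "deg_at N1 l + deg_at R2 l + (if j = l then 1 else 0) =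
        deg_at N2 l + deg_at R1 l + (if i = l then 1 else 0)" for l
      using XYat[of l] at[of l] by linarith
    have Ri: "deg_at R1 i = deg_at R2 i" using diff[of i] bal[of i] i ij by simp
    have Rj: "deg_at R1 j = deg_at R2 j" using diff[of j] bal[of j] XY(5) ij by simp
    have Rl: "deg_at N1 l + deg_at R2 l = deg_at N2 l + deg_at R1 l" if "l \<noteq> i" "l \<noteq> j" for l
      using diff[of l] that by simp
    have less1: "deg_at R2 l < deg_at R1 l \<longleftrightarrow> deg_at N2 l < deg_at N1 l \<and> l \<noteq> i" for l
      using Ri Rj Rl[of l] XY(5) by (cases "l = i"; cases "l = j") auto
    have less2: "deg_at R1 l < deg_at R2 l \<longleftrightarrow> deg_at N1 l < deg_at N2 l \<and> l \<noteq> j" for l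
      using Ri Rj Rl[of l] i by (cases "l = i"; cases "l = j") auto
    have "deg_at R1 l \<le> Suc (deg_at R2 l) \<and> deg_at R2 l \<le> Suc (deg_at R1 l)" for l
      using Ri Rj Rl[of l] bal[of l] by (cases "l = i"; cases "l = j") auto
    then have balR: "balanced (sum_mset R1) (sum_mset R2)" unfolding balanced_def by blast
    have subR: "R1 \<subseteq># M1" "R2 \<subseteq># M2"
      using less.prems(1,2) unfolding R1_def R2_def
      by (meson diff_subset_eq_self subset_mset.trans)+
    have szR: "size R1 = size R2" using less.prems(3) XY(3) by (simp add: R)
    have DR: "deg_at R2 l < deg_at R1 l \<Longrightarrow> deg_at M2 l < deg_at M1 l"
      "deg_at R1 l < deg_at R2 l \<Longrightarrow> deg_at M1 l < deg_at M2 l" for l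
      using less1[of l] less2[of l] less.prems(5,6)[of l] by auto
    from less.hyps[OF small subR szR balR DR] obtain P where P: "pairing (sum_mset R1) (sum_mset R2) P"
      and flip1: "\<And>K. K \<subseteq> P \<Longrightarrow> \<exists>N. set_mset N \<subseteq> Eg \<and> size N = size R1 \<and>
          sum_mset N + (\<Sum>p\<in>K. var_exp (fst p)) = sum_mset R1 + (\<Sum>p\<in>K. var_exp (snd p))"
      and flip2: "\<And>K. K \<subseteq> P \<Longrightarrow> \<exists>N. set_mset N \<subseteq> Eg \<and> size N = size R2 \<and>
          sum_mset N + (\<Sum>p\<in>K. var_exp (snd p)) = sum_mset R2 + (\<Sum>p\<in>K. var_exp (fst p))"
      by metis
    have ijP: "i \<notin> fst ` P" "j \<notin> snd ` P" and finP: "finite P"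
      using P Ri Rj unfolding pairing_def by auto
    then have ijP': "(i, j) \<notin> P" by force
    have "{l. deg_at N2 l < deg_at N1 l} = insert i {l. deg_at R2 l < deg_at R1 l}"
      "{l. deg_at N1 l < deg_at N2 l} = insert j {l. deg_at R1 l < deg_at R2 l}"
      using less1 less2 i XY(5) by auto
    then have pair: "pairing (sum_mset N1) (sum_mset N2) (insert (i, j) P)"
      using P ijP ijP' unfolding pairing_def by simp
    have sub: "set_mset X \<subseteq> Eg" "set_mset Y \<subseteq> Eg" using NE by (auto simp: R)
    \<comment> \<open>The peeled trail is independent of the others. If \<open>(i, j)\<close> is
      outside \<open>K\<close>, then \<open>X\<close> stays on the first side and \<open>Y\<close>
      on the second; otherwise they are swapped.\<close>
    have flips: "(\<exists>N. set_mset N \<subseteq> Eg \<and> size N = size N1 \<and>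
          sum_mset N + (\<Sum>p\<in>K. var_exp (fst p)) = sum_mset N1 + (\<Sum>p\<in>K. var_exp (snd p))) \<and>
        (\<exists>N. set_mset N \<subseteq> Eg \<and> size N = size N2 \<and>
          sum_mset N + (\<Sum>p\<in>K. var_exp (snd p)) = sum_mset N2 + (\<Sum>p\<in>K. var_exp (fst p)))"
      if K: "K \<subseteq> insert (i, j) P" for K
    proof (cases "(i, j) \<in> K")
      case False
      then have "K \<subseteq> P" using K by blast
      from flip1[OF this] flip2[OF this] obtain L1 L2 where
        L1: "set_mset L1 \<subseteq> Eg" "size L1 = size R1"
          "sum_mset L1 + (\<Sum>p\<in>K. var_exp (fst p)) = sum_mset R1 + (\<Sum>p\<in>K. var_exp (snd p))"
        and L2: "set_mset L2 \<subseteq> Eg" "size L2 = size R2"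
          "sum_mset L2 + (\<Sum>p\<in>K. var_exp (snd p)) = sum_mset R2 + (\<Sum>p\<in>K. var_exp (fst p))"
        by blast
      show ?thesis
        using L1 L2 sub
        by (intro conjI exI[of _ "X + L1"] exI[of _ "Y + L2"]) (auto simp: R add.assoc)
    next
      case True
      define K' where "K' = K - {(i, j)}"
      have K': "K' \<subseteq> P" "K = insert (i, j) K'" "(i, j) \<notin> K'" using K True unfolding K'_def by auto
      have fK: "finite K'" using finP K'(1) finite_subset by blast
      from flip1[OF K'(1)] flip2[OF K'(1)] obtain L1 L2 where
        L1: "set_mset L1 \<subseteq> Eg" "size L1 = size R1"
          "sum_mset L1 + (\<Sum>p\<in>K'. var_exp (fst p)) = sum_mset R1 + (\<Sum>p\<in>K'. var_exp (snd p))"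
        and L2: "set_mset L2 \<subseteq> Eg" "size L2 = size R2"
          "sum_mset L2 + (\<Sum>p\<in>K'. var_exp (snd p)) = sum_mset R2 + (\<Sum>p\<in>K'. var_exp (fst p))"
        by blast
      have "sum_mset (Y + L1) + (\<Sum>p\<in>K. var_exp (fst p)) =
          (sum_mset Y + var_exp i) + (sum_mset L1 + (\<Sum>p\<in>K'. var_exp (fst p)))"
        using fK K' by (simp add: ac_simps)
      also have "\<dots> = (sum_mset X + var_exp j) + (sum_mset R1 + (\<Sum>p\<in>K'. var_exp (snd p)))"
        by (simp only: XY(4) L1(3))
      also have "\<dots> = sum_mset N1 + (\<Sum>p\<in>K. var_exp (snd p))"
        using fK K' by (simp add: R ac_simps)
      finally have e1: "sum_mset (Y + L1) + (\<Sum>p\<in>K. var_exp (fst p)) =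
        sum_mset N1 + (\<Sum>p\<in>K. var_exp (snd p))" .
      have "sum_mset (X + L2) + (\<Sum>p\<in>K. var_exp (snd p)) =
          (sum_mset X + var_exp j) + (sum_mset L2 + (\<Sum>p\<in>K'. var_exp (snd p)))"
        using fK K' by (simp add: ac_simps)
      also have "\<dots> = (sum_mset Y + var_exp i) + (sum_mset R2 + (\<Sum>p\<in>K'. var_exp (fst p)))"
        by (simp only: XY(4) L2(3))
      also have "\<dots> = sum_mset N2 + (\<Sum>p\<in>K. var_exp (fst p))"
        using fK K' by (simp add: R ac_simps)
      finally have e2: "sum_mset (X + L2) + (\<Sum>p\<in>K. var_exp (snd p)) =
        sum_mset N2 + (\<Sum>p\<in>K. var_exp (fst p))" .
      show ?thesis
        using e1 e2 L1(1,2) L2(1,2) sub XY(3) less.prems(3)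
        by (intro conjI exI[of _ "Y + L1"] exI[of _ "X + L2"]) (auto simp: R)
    qed
    show ?thesis using pair flips by blast
  qed
qed

text \<open>Flipping \<open>K\<close> moves \<open>u\<close> and \<open>v\<close> one unit towards
  each other at the affected vertices. All degrees stay between those of \<open>u\<close> and
  \<open>v\<close>, so the bound \<open>c\<close> survives and the flipped multisets are matchings
  again.\<close>

lemma flippable_pairing:
  assumes "u \<in> bases" "v \<in> bases" "balanced u v"
  obtains P where "pairing u v P" "\<And>K. K \<subseteq> P \<Longrightarrow> \<exists>u'\<in>bases. \<exists>v'\<in>bases.
      u' + (\<Sum>p\<in>K. var_exp (fst p)) = u + (\<Sum>p\<in>K. var_exp (snd p)) \<and>
      v' + (\<Sum>p\<in>K. var_exp (snd p)) = v + (\<Sum>p\<in>K. var_exp (fst p))"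
proof -
  obtain M1 M2 where M: "M1 \<in> matchings" "M2 \<in> matchings" "u = sum_mset M1" "v = sum_mset M2"
    using assms(1,2) unfolding bases_def by blast
  have sz: "size M1 = q" "size M2 = q" and bd: "\<And>i. deg_at M1 i \<le> c i" "\<And>i. deg_at M2 i \<le> c i"
    using M by (auto simp: matchings_def)
  have "balanced (sum_mset M1) (sum_mset M2)" using assms(3) M by simp
  from flippable_pairing_aux[OF M(1,2) this, of M1 M2] this sz
  obtain P where P: "pairing u v P" and
    flip: "\<And>K. K \<subseteq> P \<Longrightarrow> (\<exists>N. set_mset N \<subseteq> Eg \<and> size N = q \<and>
          sum_mset N + (\<Sum>p\<in>K. var_exp (fst p)) = u + (\<Sum>p\<in>K. var_exp (snd p))) \<and>
        (\<exists>N. set_mset N \<subseteq> Eg \<and> size N = q \<and>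
          sum_mset N + (\<Sum>p\<in>K. var_exp (snd p)) = v + (\<Sum>p\<in>K. var_exp (fst p)))"
    unfolding M(3,4) by auto
  have Pd: "finite P" "inj_on fst P" "inj_on snd P"
    "fst ` P = {i. Poly_Mapping.lookup v i < Poly_Mapping.lookup u i}"
    "snd ` P = {i. Poly_Mapping.lookup u i < Poly_Mapping.lookup v i}"
    using P unfolding pairing_def by auto
  have "\<exists>u'\<in>bases. \<exists>v'\<in>bases.
      u' + (\<Sum>p\<in>K. var_exp (fst p)) = u + (\<Sum>p\<in>K. var_exp (snd p)) \<and>
      v' + (\<Sum>p\<in>K. var_exp (snd p)) = v + (\<Sum>p\<in>K. var_exp (fst p))" if K: "K \<subseteq> P" for K
  proof -
    from flip[OF K] obtain N1 N2 where N1: "set_mset N1 \<subseteq> Eg" "size N1 = q"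
        "sum_mset N1 + (\<Sum>p\<in>K. var_exp (fst p)) = u + (\<Sum>p\<in>K. var_exp (snd p))"
      and N2: "set_mset N2 \<subseteq> Eg" "size N2 = q"
        "sum_mset N2 + (\<Sum>p\<in>K. var_exp (snd p)) = v + (\<Sum>p\<in>K. var_exp (fst p))"
      by blast
    note at = sum_var_exp_at[OF Pd(1,2) K] sum_var_exp_at[OF Pd(1,3) K]
    have im: "fst ` K \<subseteq> fst ` P" "snd ` K \<subseteq> snd ` P" using K by auto
    have "deg_at N1 i \<le> c i" for i
      using arg_cong[OF N1(3), of "\<lambda>p. Poly_Mapping.lookup p i"] im bd[of i] Pd(4,5) M(3,4)
      by (auto simp: lookup_add at split: if_splits)
    then have 1: "sum_mset N1 \<in> bases" using N1(1,2) by (auto simp: bases_def matchings_def)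
    have "deg_at N2 i \<le> c i" for i
      using arg_cong[OF N2(3), of "\<lambda>p. Poly_Mapping.lookup p i"] im bd[of i] Pd(4,5) M(3,4)
      by (auto simp: lookup_add at split: if_splits)
    then have 2: "sum_mset N2 \<in> bases" using N2(1,2) by (auto simp: bases_def matchings_def)
    show ?thesis using 1 2 N1(3) N2(3) by blast
  qed
  then show thesis using that P by blast
qed

text \<open>Flipping the pairs whose surplus end is coloured False puts the larger entry of
  \<open>w1\<close> at the True end of every pair and the smaller one at the False end; balance
  makes a flip by one unit a swap of the two values. The pairing is fixed before the colouring, so a
  colouring can be chosen that suits a second pairing too.\<close>

lemma recolour:
  assumes u: "u1 \<in> bases" "u2 \<in> bases" and bal: "balanced u1 u2"
  obtains P where "pairing u1 u2 P" "\<And>f. \<forall>(a, b)\<in>P. f a \<noteq> f b \<Longrightarrow>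
    \<exists>w1\<in>bases. \<exists>w2\<in>bases. exchange_equiv bases {#u1, u2#} {#w1, w2#} \<and>
      (\<forall>i. Poly_Mapping.lookup w1 i =
        (if f i then max else min) (Poly_Mapping.lookup u1 i) (Poly_Mapping.lookup u2 i)) \<and>
      (\<forall>i. Poly_Mapping.lookup w2 i =
        (if f i then min else max) (Poly_Mapping.lookup u1 i) (Poly_Mapping.lookup u2 i))"
proof -
  obtain P where P: "pairing u1 u2 P" and flip: "\<And>K. K \<subseteq> P \<Longrightarrow> \<exists>w1\<in>bases. \<exists>w2\<in>bases.
      w1 + (\<Sum>p\<in>K. var_exp (fst p)) = u1 + (\<Sum>p\<in>K. var_exp (snd p)) \<and>
      w2 + (\<Sum>p\<in>K. var_exp (snd p)) = u2 + (\<Sum>p\<in>K. var_exp (fst p))"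
    using flippable_pairing[OF assms] by blast
  have Pd: "finite P" "inj_on fst P" "inj_on snd P"
    "fst ` P = {i. Poly_Mapping.lookup u2 i < Poly_Mapping.lookup u1 i}"
    "snd ` P = {i. Poly_Mapping.lookup u1 i < Poly_Mapping.lookup u2 i}"
    using P unfolding pairing_def by auto
  have equiv: "exchange_equiv bases {#u1, u2#} {#w1, w2#}"
    if "finite K" "K \<subseteq> P" "w1 \<in> bases" "w2 \<in> bases"
      "w1 + (\<Sum>p\<in>K. var_exp (fst p)) = u1 + (\<Sum>p\<in>K. var_exp (snd p))"
      "w2 + (\<Sum>p\<in>K. var_exp (snd p)) = u2 + (\<Sum>p\<in>K. var_exp (fst p))" for K w1 w2
    using that
  proof (induction K arbitrary: w1 w2)
    case empty
    then show ?case by (simp add: exchange_equiv.refl)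
  next
    case (insert p K)
    obtain a b where p: "p = (a, b)" by fastforce
    have KP: "K \<subseteq> P" "p \<in> P" using insert.prems(1) by auto
    obtain v1 v2 where v: "v1 \<in> bases" "v2 \<in> bases"
      "v1 + (\<Sum>p\<in>K. var_exp (fst p)) = u1 + (\<Sum>p\<in>K. var_exp (snd p))"
      "v2 + (\<Sum>p\<in>K. var_exp (snd p)) = u2 + (\<Sum>p\<in>K. var_exp (fst p))"
      using flip[OF KP(1)] by blast
    note at = sum_var_exp_at[OF Pd(1,2) KP(1)] sum_var_exp_at[OF Pd(1,3) KP(1)]
    have im: "fst ` K \<subseteq> fst ` P" "snd ` K \<subseteq> snd ` P" using KP by auto
    have ab: "a \<in> fst ` P" "b \<in> snd ` P" using KP(2) p by (auto simp: rev_image_eqI)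
    have nab: "a \<notin> fst ` K" "b \<notin> snd ` K"
      using inj_on_image_mem_iff[OF Pd(2) KP(2,1)] inj_on_image_mem_iff[OF Pd(3) KP(2,1)] insert.hyps(2) p
      by auto
    \<comment> \<open>Pairs are flipped one after another, every intermediate stage being a pair of
      bases. Flipping \<open>K\<close> does not touch the ends of \<open>p\<close>, so the strict
      inequalities required by a symmetric exchange still hold at \<open>a\<close> and
      \<open>b\<close>.\<close>
    have "Poly_Mapping.lookup v1 a = Poly_Mapping.lookup u1 a"
      "Poly_Mapping.lookup v1 b = Poly_Mapping.lookup u1 b"
      using arg_cong[OF v(3), of "\<lambda>p. Poly_Mapping.lookup p a"]
        arg_cong[OF v(3), of "\<lambda>p. Poly_Mapping.lookup p b"] nab ab im Pd(4,5)
      by (auto simp: lookup_add at split: if_splits)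
    moreover have "Poly_Mapping.lookup v2 a = Poly_Mapping.lookup u2 a"
      "Poly_Mapping.lookup v2 b = Poly_Mapping.lookup u2 b"
      using arg_cong[OF v(4), of "\<lambda>p. Poly_Mapping.lookup p a"]
        arg_cong[OF v(4), of "\<lambda>p. Poly_Mapping.lookup p b"] nab ab im Pd(4,5)
      by (auto simp: lookup_add at split: if_splits)
    ultimately have lt: "Poly_Mapping.lookup v2 a < Poly_Mapping.lookup v1 a"
      "Poly_Mapping.lookup v1 b < Poly_Mapping.lookup v2 b"
      using ab Pd(4,5) by auto
    define Fs Ss where "Fs = (\<Sum>p\<in>K. var_exp (fst p))" and "Ss = (\<Sum>p\<in>K. var_exp (snd p))"
    have w: "w1 + (var_exp a + Fs) = u1 + (var_exp b + Ss)"
      "w2 + (var_exp b + Ss) = u2 + (var_exp a + Fs)"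
      using insert.prems(4,5) insert.hyps p by (simp_all add: Fs_def Ss_def)
    have vv: "v1 + Fs = u1 + Ss" "v2 + Ss = u2 + Fs" using v by (simp_all add: Fs_def Ss_def)
    have "(w1 + var_exp a) + Fs = (v1 + var_exp b) + Fs"
      using w(1) vv(1) by (metis add.assoc add.commute)
    moreover have "(w2 + var_exp b) + Ss = (v2 + var_exp a) + Ss"
      using w(2) vv(2) by (metis add.assoc add.commute)
    ultimately have "sym_exchange bases v1 v2 w1 w2"
      unfolding sym_exchange_def using v(1,2) insert.prems(2,3) lt by auto
    then have "exchange_equiv bases ({#} + {#v1, v2#}) ({#} + {#w1, w2#})"
      by (intro exchange_equiv.step) auto
    then show ?case
      using insert.IH[OF KP(1) v] by (auto intro: exchange_equiv.trans)
  qed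
  have "\<exists>w1\<in>bases. \<exists>w2\<in>bases. exchange_equiv bases {#u1, u2#} {#w1, w2#} \<and>
      (\<forall>i. Poly_Mapping.lookup w1 i =
        (if f i then max else min) (Poly_Mapping.lookup u1 i) (Poly_Mapping.lookup u2 i)) \<and>
      (\<forall>i. Poly_Mapping.lookup w2 i =
        (if f i then min else max) (Poly_Mapping.lookup u1 i) (Poly_Mapping.lookup u2 i))"
    if f: "\<forall>(a, b)\<in>P. f a \<noteq> f b" for f
  proof -
    define K where "K = {p \<in> P. \<not> f (fst p)}"
    have KP: "K \<subseteq> P" by (auto simp: K_def)
    obtain w1 w2 where w: "w1 \<in> bases" "w2 \<in> bases"
      "w1 + (\<Sum>p\<in>K. var_exp (fst p)) = u1 + (\<Sum>p\<in>K. var_exp (snd p))"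
      "w2 + (\<Sum>p\<in>K. var_exp (snd p)) = u2 + (\<Sum>p\<in>K. var_exp (fst p))"
      using flip[OF KP] by blast
    have fK: "i \<in> fst ` K \<longleftrightarrow> i \<in> fst ` P \<and> \<not> f i" for i
      unfolding K_def by auto
    have "snd ` K = {i \<in> snd ` P. f i}"
      unfolding K_def using f by force
    then have sK: "i \<in> snd ` K \<longleftrightarrow> i \<in> snd ` P \<and> f i" for i by simp
    note at = sum_var_exp_at[OF Pd(1,2) KP] sum_var_exp_at[OF Pd(1,3) KP]
    have b: "Poly_Mapping.lookup u1 i \<le> Suc (Poly_Mapping.lookup u2 i)"
      "Poly_Mapping.lookup u2 i \<le> Suc (Poly_Mapping.lookup u1 i)" for i
      using bal unfolding balanced_def by auto
    have "Poly_Mapping.lookup w1 i =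
        (if f i then max else min) (Poly_Mapping.lookup u1 i) (Poly_Mapping.lookup u2 i)" for i
      using arg_cong[OF w(3), of "\<lambda>p. Poly_Mapping.lookup p i"] b[of i]
      by (auto simp: lookup_add at fK sK Pd(4,5) split: if_splits)
    moreover have "Poly_Mapping.lookup w2 i =
        (if f i then min else max) (Poly_Mapping.lookup u1 i) (Poly_Mapping.lookup u2 i)" for i
      using arg_cong[OF w(4), of "\<lambda>p. Poly_Mapping.lookup p i"] b[of i]
      by (auto simp: lookup_add at fK sK Pd(4,5) split: if_splits)
    moreover have "exchange_equiv bases {#u1, u2#} {#w1, w2#}"
      using equiv[OF finite_subset[OF KP Pd(1)] KP w] .
    ultimately show ?thesis using w(1,2) by blast
  qed
  then show thesis using that P by blast
qed

end

section \<open>Connectedness of the fibres\<close>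

lemma sum_mset_le_eq_imp_eq:
  fixes f g :: "'a \<Rightarrow> nat"
  assumes "\<forall>p\<in>#Z. f p \<le> g p" "(\<Sum>p\<in>#Z. f p) = (\<Sum>p\<in>#Z. g p)"
  shows "\<forall>p\<in>#Z. f p = g p"
  using assms
proof (induction Z)
  case (add x Z)
  have "(\<Sum>p\<in>#Z. f p) \<le> (\<Sum>p\<in>#Z. g p)" using add.prems(1) by (intro sum_mset_mono) auto
  moreover have "f x \<le> g x" "f x + (\<Sum>p\<in>#Z. f p) = g x + (\<Sum>p\<in>#Z. g p)"
    using add.prems by simp_all
  ultimately have "f x = g x" "(\<Sum>p\<in>#Z. f p) = (\<Sum>p\<in>#Z. g p)" by linarith+
  moreover from this(2) have "\<forall>p\<in>#Z. f p = g p"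
    by (intro add.IH) (use add.prems(1) in auto)
  ultimately show ?case by (metis insert_iff set_mset_add_mset_insert)
qed simp

lemma exchange_equiv_sum_mset:
  "exchange_equiv B M N \<Longrightarrow> sum_mset M = sum_mset N"
proof (induction rule: exchange_equiv.induct)
  case (step M u v u' v')
  then obtain i j where "u' + var_exp i = u + var_exp j" "v' + var_exp j = v + var_exp i"
    unfolding sym_exchange_def by blast
  then have "(u' + var_exp i) + (v' + var_exp j) = (u + var_exp j) + (v + var_exp i)" by simp
  then have "(u' + v') + (var_exp i + var_exp j) = (u + v) + (var_exp i + var_exp j)"
    by (simp only: ac_simps)
  then have "u' + v' = u + v" by simp
  then show ?case by (simp flip: add.assoc)
qed auto

lemma exchange_equiv_size: "exchange_equiv B M N \<Longrightarrow> size M = size N"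
  by (induction rule: exchange_equiv.induct) auto

lemma mset_pair_up:
  assumes "size M = size N"
  obtains Z where "M = image_mset fst Z" "N = image_mset snd Z"
proof -
  obtain xs ys where "mset xs = M" "mset ys = N" by (metis ex_mset)
  then have "M = image_mset fst (mset (zip xs ys))" "N = image_mset snd (mset (zip xs ys))"
    using assms by (auto simp flip: mset_map)
  then show thesis using that by blast
qed

lemma two_mem_mset:
  assumes "p \<in># Z" "p' \<in># Z" "p \<noteq> p'"
  obtains L where "Z = L + {#p, p'#}"
proof -
  obtain L where L: "Z = add_mset p L" using assms(1) by (metis mset_add)
  then have "p' \<in># L" using assms(2,3) by simp
  then obtain L' where "L = add_mset p' L'" by (metis mset_add)
  then show thesis using that[of L'] L by simp
qed

text \<open>The absolute difference: at least one of the two truncated subtractions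
  vanishes.\<close>

definition nat_dist :: "nat \<Rightarrow> nat \<Rightarrow> nat" where
  "nat_dist a b = (a - b) + (b - a)"

context bounded_matchings
begin

lemma bases_at_outside:
  assumes "u \<in> bases" "i \<notin> V"
  shows "Poly_Mapping.lookup u i = 0"
proof -
  obtain M where M: "u = sum_mset M" "set_mset M \<subseteq> Eg" using assms(1)
    by (auto simp: bases_def matchings_def)
  then have "\<forall>e\<in>#M. \<exists>i\<in>V. \<exists>j\<in>V. i \<noteq> j \<and> e = var_exp i + var_exp j" using edges by blast
  then show ?thesis unfolding M(1) using assms(2) by (rule deg_at_outside)
qed

text \<open>Where \<open>u\<close> exceeds \<open>v\<close> by at least two, moving a unit from
  \<open>u\<close> to \<open>v\<close> strictly lowers the sum of squares. The compensating unit at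
  \<open>j\<close> goes from the larger entry to the smaller one, which cannot raise it.\<close>

lemma equiv_balanced:
  assumes "set_mset M \<subseteq> bases"
  shows "\<exists>N. set_mset N \<subseteq> bases \<and> exchange_equiv bases M N \<and> (\<forall>u\<in>#N. \<forall>v\<in>#N. balanced u v)"
  using assms
proof (induction "\<Sum>u\<in>#M. \<Sum>l\<in>V. (Poly_Mapping.lookup u l)\<^sup>2" arbitrary: M rule: less_induct)
  case less
  show ?case
  proof (cases "\<forall>u\<in>#M. \<forall>v\<in>#M. balanced u v")
    case True
    then show ?thesis using less.prems exchange_equiv.refl by blast
  next
    case False
    then obtain u v where "u \<in># M" "v \<in># M" "\<not> balanced u v" by blast
    then obtain u v i where uv: "u \<in># M" "v \<in># M"
      and i: "Suc (Poly_Mapping.lookup v i) < Poly_Mapping.lookup u i"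
      unfolding balanced_def by (metis not_less)
    then have "u \<noteq> v" by auto
    then obtain L where L: "M = L + {#u, v#}" using two_mem_mset uv by metis
    have uvB: "u \<in> bases" "v \<in> bases" and LB: "set_mset L \<subseteq> bases" using less.prems L by auto
    obtain j u' v' where j: "Poly_Mapping.lookup u j < Poly_Mapping.lookup v j"
      and uv': "u' \<in> bases" "v' \<in> bases"
        "u' + var_exp i = u + var_exp j" "v' + var_exp j = v + var_exp i"
      using symmetric_exchange[OF uvB, of i] i by auto
    have iV: "i \<in> V" using bases_at_outside[OF uvB(1), of i] i by fastforce
    have ij: "i \<noteq> j" using i j by auto
    have at: "Poly_Mapping.lookup u' l + (if i = l then 1 else 0) =
        Poly_Mapping.lookup u l + (if j = l then 1 else 0)"
      "Poly_Mapping.lookup v' l + (if j = l then 1 else 0) =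
        Poly_Mapping.lookup v l + (if i = l then 1 else 0)" for l
      using arg_cong[OF uv'(3), of "\<lambda>p. Poly_Mapping.lookup p l"]
        arg_cong[OF uv'(4), of "\<lambda>p. Poly_Mapping.lookup p l"]
      by (simp_all add: lookup_add lookup_var_exp)
    let ?s = "\<lambda>u v l. (Poly_Mapping.lookup u l)\<^sup>2 + (Poly_Mapping.lookup v l)\<^sup>2"
    have sq: "x\<^sup>2 + (Suc y)\<^sup>2 \<le> (Suc x)\<^sup>2 + y\<^sup>2 \<and> (y < x \<longrightarrow> x\<^sup>2 + (Suc y)\<^sup>2 < (Suc x)\<^sup>2 + y\<^sup>2)"
      if "y \<le> x" for x y :: nat
      using that by (simp add: power2_eq_square)
    have ui: "Poly_Mapping.lookup u i = Suc (Poly_Mapping.lookup u' i)"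
      "Poly_Mapping.lookup v' i = Suc (Poly_Mapping.lookup v i)"
      using at[of i] ij by simp_all
    have si: "?s u' v' i < ?s u v i"
      using sq[of "Poly_Mapping.lookup v i" "Poly_Mapping.lookup u' i"] ui i by simp
    have uj: "Poly_Mapping.lookup u' j = Suc (Poly_Mapping.lookup u j)"
      "Poly_Mapping.lookup v j = Suc (Poly_Mapping.lookup v' j)"
      using at[of j] ij by simp_all
    have sj: "?s u' v' j \<le> ?s u v j"
      using sq[of "Poly_Mapping.lookup u j" "Poly_Mapping.lookup v' j"] uj j by simp
    have "?s u' v' l \<le> ?s u v l" for l
      using si sj at[of l] by (cases "l = i"; cases "l = j") auto
    then have "(\<Sum>l\<in>V. ?s u' v' l) < (\<Sum>l\<in>V. ?s u v l)"
      using si iV finite_V by (intro sum_strict_mono_ex1) auto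
    then have less': "(\<Sum>u\<in>#L + {#u', v'#}. \<Sum>l\<in>V. (Poly_Mapping.lookup u l)\<^sup>2) <
        (\<Sum>u\<in>#M. \<Sum>l\<in>V. (Poly_Mapping.lookup u l)\<^sup>2)"
      unfolding L by (simp add: sum.distrib)
    have "sym_exchange bases u v u' v'"
      unfolding sym_exchange_def using uvB uv' i j
      by (intro conjI exI[of _ i] exI[of _ j]) auto
    then have "exchange_equiv bases M (L + {#u', v'#})"
      unfolding L by (rule exchange_equiv.step[OF LB])
    then show ?thesis
      using less.hyps[OF less'] LB uv'(1,2) by (auto intro: exchange_equiv.trans)
  qed
qed

text \<open>Two pairs \<open>(u1, v1)\<close>, \<open>(u2, v2)\<close> in which \<open>u1 - v1\<close> and \<open>u2 - v2\<close> have opposite signs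
  at \<open>x\<close> are replaced by the coordinatewise maxima and minima of \<open>u1, u2\<close> and of \<open>v1, v2\<close>,
  distributed according to one colouring of the vertices.\<close>
lemma equiv_of_balanced_pairs:
  assumes "fst ` set_mset Z \<subseteq> bases" "snd ` set_mset Z \<subseteq> bases"
    and "\<forall>p\<in>#Z. \<forall>p'\<in>#Z. balanced (fst p) (fst p')"
    and "\<forall>p\<in>#Z. \<forall>p'\<in>#Z. balanced (snd p) (snd p')"
    and "sum_mset (image_mset fst Z) = sum_mset (image_mset snd Z)"
  shows "exchange_equiv bases (image_mset fst Z) (image_mset snd Z)"
  using assms
proof (induction "\<Sum>p\<in>#Z. \<Sum>l\<in>V. nat_dist (Poly_Mapping.lookup (fst p) l) (Poly_Mapping.lookup (snd p) l)"
    arbitrary: Z rule: less_induct)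
  case less
  let ?d = "\<lambda>u v l. nat_dist (Poly_Mapping.lookup u l) (Poly_Mapping.lookup v l)"
  show ?case
  proof (cases "\<forall>p\<in>#Z. fst p = snd p")
    case True
    then have "image_mset fst Z = image_mset snd Z" by (intro image_mset_cong) auto
    then show ?thesis by (simp add: exchange_equiv.refl)
  next
    case False
    then obtain p where p: "p \<in># Z" "fst p \<noteq> snd p" by blast
    then obtain x where x: "Poly_Mapping.lookup (fst p) x \<noteq> Poly_Mapping.lookup (snd p) x"
      by (metis poly_mapping_eqI)
    have sums: "(\<Sum>p\<in>#Z. Poly_Mapping.lookup (fst p) x) = (\<Sum>p\<in>#Z. Poly_Mapping.lookup (snd p) x)"
      using arg_cong[OF less.prems(5), of "\<lambda>p. Poly_Mapping.lookup p x"]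
      by (simp add: lookup_sum_mset image_mset.compositionality comp_def)
    \<comment> \<open>The totals at \<open>x\<close> agree although some pair differs there, so
      differences of both signs occur.\<close>
    obtain p1 where p1: "p1 \<in># Z" "Poly_Mapping.lookup (snd p1) x < Poly_Mapping.lookup (fst p1) x"
      using sum_mset_le_eq_imp_eq[OF _ sums] p(1) x by (meson not_less)
    obtain p2 where p2: "p2 \<in># Z" "Poly_Mapping.lookup (fst p2) x < Poly_Mapping.lookup (snd p2) x"
      using sum_mset_le_eq_imp_eq[OF _ sums[symmetric]] p(1) x by (metis not_less)
    obtain u1 v1 u2 v2 where pe: "p1 = (u1, v1)" "p2 = (u2, v2)" by fastforce
    have "p1 \<noteq> p2" using p1 p2 by auto
    then obtain L where L: "Z = L + {#(u1, v1), (u2, v2)#}"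
      using two_mem_mset[OF p1(1) p2(1)] pe by metis
    have B: "u1 \<in> bases" "u2 \<in> bases" "v1 \<in> bases" "v2 \<in> bases"
      and LB: "fst ` set_mset L \<subseteq> bases" "snd ` set_mset L \<subseteq> bases"
      and bal: "balanced u1 u2" "balanced v1 v2"
      using less.prems(1-4) by (auto simp: L)
    obtain P where P: "pairing u1 u2 P" and recP: "\<And>f. \<forall>(a, b)\<in>P. f a \<noteq> f b \<Longrightarrow>
      \<exists>w1\<in>bases. \<exists>w2\<in>bases. exchange_equiv bases {#u1, u2#} {#w1, w2#} \<and>
        (\<forall>i. Poly_Mapping.lookup w1 i =
          (if f i then max else min) (Poly_Mapping.lookup u1 i) (Poly_Mapping.lookup u2 i)) \<and>
        (\<forall>i. Poly_Mapping.lookup w2 i =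
          (if f i then min else max) (Poly_Mapping.lookup u1 i) (Poly_Mapping.lookup u2 i))"
      using recolour[OF B(1,2) bal(1)] by blast
    obtain Q where Q: "pairing v1 v2 Q" and recQ: "\<And>f. \<forall>(a, b)\<in>Q. f a \<noteq> f b \<Longrightarrow>
      \<exists>w1\<in>bases. \<exists>w2\<in>bases. exchange_equiv bases {#v1, v2#} {#w1, w2#} \<and>
        (\<forall>i. Poly_Mapping.lookup w1 i =
          (if f i then max else min) (Poly_Mapping.lookup v1 i) (Poly_Mapping.lookup v2 i)) \<and>
        (\<forall>i. Poly_Mapping.lookup w2 i =
          (if f i then min else max) (Poly_Mapping.lookup v1 i) (Poly_Mapping.lookup v2 i))"
      using recolour[OF B(3,4) bal(2)] by blast
    have PQ: "finite P" "finite Q" "inj_on fst P" "inj_on snd P" "fst ` P \<inter> snd ` P = {}"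
      "inj_on fst Q" "inj_on snd Q" "fst ` Q \<inter> snd ` Q = {}"
      using P Q unfolding pairing_def by auto
    obtain f :: "'v \<Rightarrow> bool" where f: "\<forall>(a, b)\<in>P \<union> Q. f a \<noteq> f b"
      using two_matchings_colouring[OF PQ] by blast
    obtain w1 w2 where w: "w1 \<in> bases" "w2 \<in> bases" "exchange_equiv bases {#u1, u2#} {#w1, w2#}"
      "\<And>i. Poly_Mapping.lookup w1 i =
          (if f i then max else min) (Poly_Mapping.lookup u1 i) (Poly_Mapping.lookup u2 i)"
      "\<And>i. Poly_Mapping.lookup w2 i =
          (if f i then min else max) (Poly_Mapping.lookup u1 i) (Poly_Mapping.lookup u2 i)"
      using recP[of f] f by blast
    obtain y1 y2 where y: "y1 \<in> bases" "y2 \<in> bases" "exchange_equiv bases {#v1, v2#} {#y1, y2#}"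
      "\<And>i. Poly_Mapping.lookup y1 i =
          (if f i then max else min) (Poly_Mapping.lookup v1 i) (Poly_Mapping.lookup v2 i)"
      "\<And>i. Poly_Mapping.lookup y2 i =
          (if f i then min else max) (Poly_Mapping.lookup v1 i) (Poly_Mapping.lookup v2 i)"
      using recQ[of f] f by blast
    define Z' where "Z' = L + {#(w1, y1), (w2, y2)#}"
    \<comment> \<open>At each vertex the common colouring matches maximum with maximum and minimum
      with minimum, which never increases the total distance.\<close>
    have le: "?d w1 y1 l + ?d w2 y2 l \<le> ?d u1 v1 l + ?d u2 v2 l" for l
      unfolding w(4,5) y(4,5) nat_dist_def by (auto simp: max_def min_def)
    \<comment> \<open>At \<open>x\<close> the chain v1 < u1 \<le> u2 + 1 \<le> v2 \<le> v1 + 1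
      forces u1 = v2 and u2 = v1. Maxima and minima then coincide, and the distance at
      \<open>x\<close> drops from 2 to 0.\<close>
    have "Poly_Mapping.lookup u1 x \<le> Suc (Poly_Mapping.lookup u2 x)"
      "Poly_Mapping.lookup v2 x \<le> Suc (Poly_Mapping.lookup v1 x)"
      using bal unfolding balanced_def by auto
    then have lt: "?d w1 y1 x + ?d w2 y2 x < ?d u1 v1 x + ?d u2 v2 x"
      using p1(2) p2(2) unfolding w(4,5) y(4,5) nat_dist_def by (auto simp: pe max_def min_def)
    have xV: "x \<in> V" using bases_at_outside[OF B(1), of x] p1(2) pe by fastforce
    have "(\<Sum>l\<in>V. ?d w1 y1 l + ?d w2 y2 l) < (\<Sum>l\<in>V. ?d u1 v1 l + ?d u2 v2 l)"
      using le lt xV finite_V by (intro sum_strict_mono_ex1) auto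
    then have less': "(\<Sum>p\<in>#Z'. \<Sum>l\<in>V. ?d (fst p) (snd p) l) < (\<Sum>p\<in>#Z. \<Sum>l\<in>V. ?d (fst p) (snd p) l)"
      unfolding L Z'_def by (simp add: sum.distrib)
    \<comment> \<open>Every coordinate of a new entry is the same coordinate of some old entry on
      that side, so pairwise balance is inherited.\<close>
    have old1: "\<exists>t\<in>#Z. Poly_Mapping.lookup (fst p) i = Poly_Mapping.lookup (fst t) i"
      if "p \<in># Z'" for p i
      using that unfolding Z'_def L by (auto simp: w(4,5) max_def min_def split: if_splits)
    have old2: "\<exists>t\<in>#Z. Poly_Mapping.lookup (snd p) i = Poly_Mapping.lookup (snd t) i"
      if "p \<in># Z'" for p i
      using that unfolding Z'_def L by (auto simp: y(4,5) max_def min_def split: if_splits)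
    have bal1: "\<forall>p\<in>#Z'. \<forall>p'\<in>#Z'. balanced (fst p) (fst p')"
      using old1 less.prems(3) unfolding balanced_def by metis
    have bal2: "\<forall>p\<in>#Z'. \<forall>p'\<in>#Z'. balanced (snd p) (snd p')"
      using old2 less.prems(4) unfolding balanced_def by metis
    have e1: "exchange_equiv bases (image_mset fst Z) (image_mset fst Z')"
      using exchange_equiv_add[OF w(3), of "image_mset fst L"] LB(1) by (simp add: L Z'_def)
    have e2: "exchange_equiv bases (image_mset snd Z) (image_mset snd Z')"
      using exchange_equiv_add[OF y(3), of "image_mset snd L"] LB(2) by (simp add: L Z'_def)
    have "sum_mset (image_mset fst Z') = sum_mset (image_mset snd Z')"
      using exchange_equiv_sum_mset[OF e1] exchange_equiv_sum_mset[OF e2] less.prems(5) by simp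
    moreover have "fst ` set_mset Z' \<subseteq> bases" "snd ` set_mset Z' \<subseteq> bases"
      using LB w(1,2) y(1,2) by (auto simp: Z'_def)
    ultimately have "exchange_equiv bases (image_mset fst Z') (image_mset snd Z')"
      using less.hyps[OF less'] bal1 bal2 by blast
    then show ?thesis using e1 e2 by (blast intro: exchange_equiv.intros)
  qed
qed

text \<open>Once both multisets are balanced their entries may be paired arbitrarily:
  \<open>equiv_of_balanced_pairs\<close> asks nothing of the individual pairs beyond membership and
  balance on each side.\<close>

theorem equiv_of_equal_sums:
  assumes "set_mset M \<subseteq> bases" "set_mset N \<subseteq> bases" "size M = size N" "sum_mset M = sum_mset N"
  shows "exchange_equiv bases M N"
proof -
  obtain M' where M': "set_mset M' \<subseteq> bases" "exchange_equiv bases M M'" "\<forall>u\<in>#M'. \<forall>v\<in>#M'. balanced u v"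
    using equiv_balanced[OF assms(1)] by blast
  obtain N' where N': "set_mset N' \<subseteq> bases" "exchange_equiv bases N N'" "\<forall>u\<in>#N'. \<forall>v\<in>#N'. balanced u v"
    using equiv_balanced[OF assms(2)] by blast
  have "size M' = size N'"
    using assms(3) exchange_equiv_size M'(2) N'(2) by metis
  then obtain Z where Z: "M' = image_mset fst Z" "N' = image_mset snd Z" by (rule mset_pair_up)
  have "sum_mset M' = sum_mset N'"
    using assms(4) exchange_equiv_sum_mset M'(2) N'(2) by metis
  then have "exchange_equiv bases M' N'"
    using M'(1,3) N'(1,3) unfolding Z by (intro equiv_of_balanced_pairs) auto
  then show ?thesis using M'(2) N'(2) by (blast intro: exchange_equiv.intros)
qed

end

section \<open>The toric ideal\<close>

lemma poly_ring_zero: "0 \<in> poly_ring V"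
  by (simp add: poly_ring_def)

lemma poly_ring_add: "p \<in> poly_ring V \<Longrightarrow> r \<in> poly_ring V \<Longrightarrow> p + r \<in> poly_ring V"
  using Poly_Mapping.keys_add[of p r] unfolding poly_ring_def by blast

lemma poly_ring_uminus: "p \<in> poly_ring V \<Longrightarrow> - p \<in> poly_ring V"
  for p :: "('v, 'k::ab_group_add) mpoly"
  by (simp add: poly_ring_def)

lemma poly_ring_mult:
  assumes "p \<in> poly_ring V" "r \<in> poly_ring V"
  shows "p * r \<in> poly_ring V"
proof -
  have "Poly_Mapping.keys m \<subseteq> V" if m: "m \<in> Poly_Mapping.keys (p * r)" for m
  proof -
    obtain a b where "a \<in> Poly_Mapping.keys p" "b \<in> Poly_Mapping.keys r" "m = a + b"
      using m keys_mult[of p r] by blast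
    then show ?thesis using assms Poly_Mapping.keys_add[of a b] unfolding poly_ring_def by blast
  qed
  then show ?thesis unfolding poly_ring_def by blast
qed

lemma poly_ring_single: "Poly_Mapping.keys m \<subseteq> V \<Longrightarrow> Poly_Mapping.single m a \<in> poly_ring V"
  by (auto simp: poly_ring_def)

lemma poly_ring_sum: "(\<And>x. x \<in> A \<Longrightarrow> f x \<in> poly_ring V) \<Longrightarrow> sum f A \<in> poly_ring V"
  by (induction A rule: infinite_finite_induct) (auto intro: poly_ring_zero poly_ring_add)

lemma ideal_gen_smult:
  fixes S :: "('v, 'k::comm_ring_1) mpoly set"
  assumes "r \<in> poly_ring V" "p \<in> ideal_gen (poly_ring V) S"
  shows "r * p \<in> ideal_gen (poly_ring V) S"
proof -
  obtain F c where "finite F" "F \<subseteq> S" "\<forall>f\<in>F. c f \<in> poly_ring V" "p = (\<Sum>f\<in>F. c f * f)"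
    using assms(2) unfolding ideal_gen_def by blast
  moreover from this have "r * p = (\<Sum>f\<in>F. (r * c f) * f)"
    by (simp add: sum_distrib_left mult.assoc)
  ultimately show ?thesis
    unfolding ideal_gen_def using poly_ring_mult[OF assms(1)]
    by (intro CollectI exI[of _ F] exI[of _ "\<lambda>f. r * c f"]) auto
qed

lemma ideal_gen_base:
  fixes S :: "('v, 'k::comm_ring_1) mpoly set"
  assumes "f \<in> S"
  shows "f \<in> ideal_gen (poly_ring V) S"
proof -
  have "(1 :: ('v, 'k) mpoly) \<in> poly_ring V"
    using poly_ring_single[of 0 V "1::'k"] by simp
  then show ?thesis
    unfolding ideal_gen_def using assms
    by (intro CollectI exI[of _ "{f}"] exI[of _ "\<lambda>_. 1"]) auto
qed

lemma ideal_gen_zero: "0 \<in> ideal_gen R S"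
  unfolding ideal_gen_def by (intro CollectI exI[of _ "{}"]) auto

lemma ideal_gen_add:
  fixes S :: "('v, 'k::comm_ring_1) mpoly set"
  assumes "p \<in> ideal_gen (poly_ring V) S" "r \<in> ideal_gen (poly_ring V) S"
  shows "p + r \<in> ideal_gen (poly_ring V) S"
proof -
  obtain F c where F: "finite F" "F \<subseteq> S" "\<forall>f\<in>F. c f \<in> poly_ring V" "p = (\<Sum>f\<in>F. c f * f)"
    using assms(1) unfolding ideal_gen_def by blast
  obtain G d where G: "finite G" "G \<subseteq> S" "\<forall>f\<in>G. d f \<in> poly_ring V" "r = (\<Sum>f\<in>G. d f * f)"
    using assms(2) unfolding ideal_gen_def by blast
  \<comment> \<open>Each generator carries a single coefficient, so both families are extended by
    zero to the common index set and added.\<close>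
  define c' where "c' f = (if f \<in> F then c f else 0)" for f
  define d' where "d' f = (if f \<in> G then d f else 0)" for f
  have "p = (\<Sum>f\<in>F \<union> G. c' f * f)"
    unfolding F(4) c'_def using F(1) G(1) by (intro sum.mono_neutral_cong_left) auto
  moreover have "r = (\<Sum>f\<in>F \<union> G. d' f * f)"
    unfolding G(4) d'_def using F(1) G(1) by (intro sum.mono_neutral_cong_left) auto
  ultimately have "p + r = (\<Sum>f\<in>F \<union> G. (c' f + d' f) * f)"
    by (simp add: sum.distrib distrib_right)
  moreover have "\<forall>f\<in>F \<union> G. c' f + d' f \<in> poly_ring V"
    using F(3) G(3) by (auto simp: c'_def d'_def intro!: poly_ring_add poly_ring_zero)
  ultimately show ?thesis
    unfolding ideal_gen_def using F(1,2) G(1,2)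
    by (intro CollectI exI[of _ "F \<union> G"] exI[of _ "\<lambda>f. c' f + d' f"]) auto
qed

lemma ideal_gen_uminus:
  fixes S :: "('v, 'k::comm_ring_1) mpoly set"
  assumes "p \<in> ideal_gen (poly_ring V) S"
  shows "- p \<in> ideal_gen (poly_ring V) S"
proof -
  have "Poly_Mapping.single 0 (- 1) \<in> poly_ring V" by (rule poly_ring_single) simp
  from ideal_gen_smult[OF this assms] show ?thesis
    by (simp add: single_uminus)
qed

lemma ideal_gen_sum:
  fixes S :: "('v, 'k::comm_ring_1) mpoly set"
  shows "(\<And>x. x \<in> A \<Longrightarrow> f x \<in> ideal_gen (poly_ring V) S) \<Longrightarrow> sum f A \<in> ideal_gen (poly_ring V) S"
  by (induction A rule: infinite_finite_induct) (auto intro: ideal_gen_zero ideal_gen_add)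

section \<open>The toric map and its kernel\<close>

lemma poly_mapping_sum_single:
  "P = (\<Sum>\<alpha>\<in>Poly_Mapping.keys P. Poly_Mapping.single \<alpha> (Poly_Mapping.lookup P \<alpha>))"
proof (rule poly_mapping_eqI)
  fix k
  show "Poly_Mapping.lookup P k = Poly_Mapping.lookup
    (\<Sum>\<alpha>\<in>Poly_Mapping.keys P. Poly_Mapping.single \<alpha> (Poly_Mapping.lookup P \<alpha>)) k"
    by (simp add: lookup_sum lookup_single when_def in_keys_iff)
qed

lemma keys_var_exp: "Poly_Mapping.keys (var_exp w) = {w}"
  by (simp add: var_exp_def)

text \<open>The exponent of the image of the monomial \<alpha> under the toric map; the inner sum of
  a constant is a scalar multiple of \<open>w\<close>.\<close>

definition toric_weight :: "'v monom monom \<Rightarrow> 'v monom" where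
  "toric_weight \<alpha> = (\<Sum>w\<in>Poly_Mapping.keys \<alpha>. \<Sum>j<Poly_Mapping.lookup \<alpha> w. w)"

lemma toric_weight_superset:
  assumes "finite A" "Poly_Mapping.keys \<alpha> \<subseteq> A"
  shows "toric_weight \<alpha> = (\<Sum>w\<in>A. \<Sum>j<Poly_Mapping.lookup \<alpha> w. w)"
  unfolding toric_weight_def using assms
  by (intro sum.mono_neutral_left) (auto simp: in_keys_iff)

lemma toric_weight_add: "toric_weight (\<alpha> + \<beta>) = toric_weight \<alpha> + toric_weight \<beta>"
proof -
  let ?A = "Poly_Mapping.keys \<alpha> \<union> Poly_Mapping.keys \<beta>"
  have rep: "(\<Sum>j<a + b. w) = (\<Sum>j<a. w) + (\<Sum>j<b. w)" for a b :: nat and w :: "'a monom"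
    by (induction b) (simp_all add: ac_simps)
  show ?thesis
    using toric_weight_superset[of ?A \<alpha>] toric_weight_superset[of ?A \<beta>]
      toric_weight_superset[of ?A "\<alpha> + \<beta>"] Poly_Mapping.keys_add[of \<alpha> \<beta>]
    by (simp add: lookup_add rep sum.distrib)
qed

lemma toric_weight_var_exp: "toric_weight (var_exp w) = w"
  by (simp add: toric_weight_def var_exp_def)

lemma toric_weight_sum_mset: "toric_weight (sum_mset (image_mset var_exp M)) = sum_mset M"
proof (induction M)
  case empty
  show ?case by (simp add: toric_weight_def)
qed (simp add: toric_weight_add toric_weight_var_exp)

lemma toric_map_superset:
  assumes "finite A" "Poly_Mapping.keys P \<subseteq> A"
  shows "toric_map P = (\<Sum>\<alpha>\<in>A. Poly_Mapping.single (toric_weight \<alpha>) (Poly_Mapping.lookup P \<alpha>))"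
  unfolding toric_map_def toric_weight_def[symmetric] using assms
  by (intro sum.mono_neutral_left) (auto simp: in_keys_iff)

lemma toric_map_add: "toric_map (P + Q) = toric_map P + toric_map Q"
proof -
  let ?A = "Poly_Mapping.keys P \<union> Poly_Mapping.keys Q"
  show ?thesis
    using toric_map_superset[of ?A P] toric_map_superset[of ?A Q]
      toric_map_superset[of ?A "P + Q"] Poly_Mapping.keys_add[of P Q]
    by (simp add: lookup_add single_add sum.distrib)
qed

lemma toric_map_sum: "toric_map (sum f A) = (\<Sum>x\<in>A. toric_map (f x))"
proof -
  have "toric_map 0 = 0" by (simp add: toric_map_def)
  then show ?thesis
    by (induction A rule: infinite_finite_induct) (simp_all add: toric_map_add)
qed

lemma toric_map_single: "toric_map (Poly_Mapping.single \<alpha> a) = Poly_Mapping.single (toric_weight \<alpha>) a"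
  using toric_map_superset[of "{\<alpha>}" "Poly_Mapping.single \<alpha> a"] by simp

text \<open>Additivity reduces the claim to a single term of \<open>P\<close>. Its two products with
  the binomial have equal weight and opposite coefficients, so their images cancel.\<close>

lemma toric_map_mult_binomial:
  fixes P :: "('v monom, 'k::comm_ring_1) mpoly"
  assumes "toric_weight \<alpha> = toric_weight \<beta>"
  shows "toric_map (P * (mono \<alpha> - mono \<beta>)) = 0"
proof -
  have "toric_map (Poly_Mapping.single \<gamma> a * (mono \<alpha> - mono \<beta>)) = 0" for \<gamma> and a :: 'k
  proof -
    have "Poly_Mapping.single \<gamma> a * (mono \<alpha> - mono \<beta>) =
        Poly_Mapping.single (\<gamma> + \<alpha>) a + Poly_Mapping.single (\<gamma> + \<beta>) (- a)"
      by (simp add: mono_def right_diff_distrib mult_single single_uminus)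
    then show ?thesis
      using assms by (simp add: toric_map_add toric_map_single toric_weight_add flip: single_add)
  qed
  then have "toric_map ((\<Sum>\<gamma>\<in>Poly_Mapping.keys P.
      Poly_Mapping.single \<gamma> (Poly_Mapping.lookup P \<gamma>)) * (mono \<alpha> - mono \<beta>)) = 0"
    by (simp add: sum_distrib_right toric_map_sum)
  then show ?thesis by (simp flip: poly_mapping_sum_single)
qed

lemma monom_of_mset:
  assumes "Poly_Mapping.keys \<alpha> \<subseteq> B"
  obtains M where "set_mset M \<subseteq> B" "\<alpha> = sum_mset (image_mset var_exp M)"
proof -
  define M where "M = (\<Sum>w\<in>Poly_Mapping.keys \<alpha>. replicate_mset (Poly_Mapping.lookup \<alpha> w) w)"
  have count: "count M w = Poly_Mapping.lookup \<alpha> w" for w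
    by (simp add: M_def count_sum in_keys_iff)
  have "Poly_Mapping.lookup (sum_mset (image_mset var_exp N)) w = count N w" for N :: "'a multiset" and w
    by (induction N) (simp_all add: lookup_add lookup_var_exp)
  then have "\<alpha> = sum_mset (image_mset var_exp M)"
    using count by (intro poly_mapping_eqI) simp
  moreover have "set_mset M \<subseteq> B"
    using assms count by (metis count_eq_zero_iff in_keys_iff subset_iff)
  ultimately show thesis using that by blast
qed

lemma sym_exchange_binomials_eq:
  "sym_exchange_binomials B =
    {mono (var_exp u + var_exp v) - mono (var_exp u' + var_exp v') | u v u' v'. sym_exchange B u v u' v'}"
  unfolding sym_exchange_binomials_def sym_exchange_def by blast

text \<open>A step is an exchange binomial times the monomial of the unchanged entries; symmetry is
  negation and transitivity is a telescoping sum.\<close>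

lemma exchange_equiv_binomial:
  assumes "exchange_equiv B M N"
  shows "(mono (sum_mset (image_mset var_exp M)) - mono (sum_mset (image_mset var_exp N))
    :: ('v monom, 'k::comm_ring_1) mpoly) \<in> ideal_gen (poly_ring B) (sym_exchange_binomials B)"
  using assms
proof induction
  case (step M u v u' v')
  let ?x = "sum_mset (image_mset var_exp M)"
  have keys_sub: "Poly_Mapping.keys ?x \<subseteq> B" using step.hyps(1)
  proof (induction M)
    case (add w M)
    then show ?case
      using Poly_Mapping.keys_add[of "var_exp w" "sum_mset (image_mset var_exp M)"]
      by (auto simp: keys_var_exp)
  qed simp
  have "mono (var_exp u + var_exp v) - mono (var_exp u' + var_exp v')
      \<in> ideal_gen (poly_ring B) (sym_exchange_binomials B :: ('v monom, 'k) mpoly set)"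
    using step.hyps(2) by (intro ideal_gen_base) (auto simp: sym_exchange_binomials_eq)
  from ideal_gen_smult[OF poly_ring_single[OF keys_sub] this, of 1]
  show ?case
    by (simp add: mono_def right_diff_distrib mult_single ac_simps)
next
  case (sym M N)
  from ideal_gen_uminus[OF sym.IH] show ?case by simp
next
  case (trans L M N)
  from ideal_gen_add[OF trans.IH] show ?case by simp
qed (simp add: ideal_gen_zero)

text \<open>The terms of a kernel element are grouped by weight. In each group the coefficients sum
  to zero, so replacing every monomial by one representative of its group yields zero. Subtracting
  this writes \<open>P\<close> as a combination of binomials within fibres, which
  \<open>equiv\<close> connects by exchanges.\<close>

theorem toric_ideal_generated_by_exchanges:
  fixes B :: "'v monom set"
  assumes equiv: "\<And>M N. set_mset M \<subseteq> B \<Longrightarrow> set_mset N \<subseteq> B \<Longrightarrow> sum_mset M = sum_mset N \<Longrightarrow>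
    exchange_equiv B M N"
  shows "(toric_ideal B :: ('v monom, 'k::comm_ring_1) mpoly set) =
    ideal_gen (poly_ring B) (sym_exchange_binomials B)"
proof (intro equalityI subsetI)
  fix P :: "('v monom, 'k) mpoly"
  assume "P \<in> toric_ideal B"
  then have P: "P \<in> poly_ring B" "toric_map P = 0" by (simp_all add: toric_ideal_def)
  let ?K = "Poly_Mapping.keys P" and ?l = "Poly_Mapping.lookup P"
  have keysB: "Poly_Mapping.keys \<alpha> \<subseteq> B" if "\<alpha> \<in> ?K" for \<alpha>
    using P(1) that by (auto simp: poly_ring_def)
  have "\<forall>m\<in>toric_weight ` ?K. \<exists>\<alpha>. \<alpha> \<in> ?K \<and> toric_weight \<alpha> = m" by blast
  \<comment> \<open>\<open>r\<close> chooses a representative monomial for each weight that occurs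
    in \<open>P\<close>.\<close>
  then obtain r where r: "\<And>m. m \<in> toric_weight ` ?K \<Longrightarrow> r m \<in> ?K \<and> toric_weight (r m) = m"
    by metis
  have coeffs: "(\<Sum>\<alpha>\<in>{\<alpha> \<in> ?K. toric_weight \<alpha> = m}. ?l \<alpha>) = 0" for m
  proof -
    have "(\<Sum>\<alpha>\<in>{\<alpha> \<in> ?K. toric_weight \<alpha> = m}. ?l \<alpha>) = Poly_Mapping.lookup (toric_map P) m"
      by (simp add: toric_map_superset[of ?K P] lookup_sum lookup_single when_def sum.If_cases Int_def)
    then show ?thesis using P(2) by simp
  qed
  have "(\<Sum>\<alpha>\<in>?K. Poly_Mapping.single (r (toric_weight \<alpha>)) (?l \<alpha>)) =
      (\<Sum>m\<in>toric_weight ` ?K. \<Sum>\<alpha>\<in>{\<alpha> \<in> ?K. toric_weight \<alpha> = m}.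
        Poly_Mapping.single (r (toric_weight \<alpha>)) (?l \<alpha>))"
    by (rule sum.image_gen) simp
  also have "\<dots> = (\<Sum>m\<in>toric_weight ` ?K. Poly_Mapping.single (r m)
      (\<Sum>\<alpha>\<in>{\<alpha> \<in> ?K. toric_weight \<alpha> = m}. ?l \<alpha>))"
  proof (rule sum.cong[OF HOL.refl])
    have "(\<Sum>\<alpha>\<in>A. Poly_Mapping.single b (?l \<alpha>)) = Poly_Mapping.single b (\<Sum>\<alpha>\<in>A. ?l \<alpha>)" for A b
      by (induction A rule: infinite_finite_induct) (simp_all add: single_add)
    then show "(\<Sum>\<alpha>\<in>{\<alpha> \<in> ?K. toric_weight \<alpha> = m}. Poly_Mapping.single (r (toric_weight \<alpha>)) (?l \<alpha>)) =
      Poly_Mapping.single (r m) (\<Sum>\<alpha>\<in>{\<alpha> \<in> ?K. toric_weight \<alpha> = m}. ?l \<alpha>)" for m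
      by simp
  qed
  finally have rest: "(\<Sum>\<alpha>\<in>?K. Poly_Mapping.single (r (toric_weight \<alpha>)) (?l \<alpha>)) = 0"
    by (simp add: coeffs)
  have "P = (\<Sum>\<alpha>\<in>?K. Poly_Mapping.single \<alpha> (?l \<alpha>)) -
      (\<Sum>\<alpha>\<in>?K. Poly_Mapping.single (r (toric_weight \<alpha>)) (?l \<alpha>))"
    unfolding rest using poly_mapping_sum_single[of P] by simp
  also have "\<dots> = (\<Sum>\<alpha>\<in>?K. Poly_Mapping.single 0 (?l \<alpha>) * (mono \<alpha> - mono (r (toric_weight \<alpha>))))"
    by (simp add: mono_def right_diff_distrib mult_single flip: sum_subtractf)
  also have "\<dots> \<in> ideal_gen (poly_ring B) (sym_exchange_binomials B)"
  proof (intro ideal_gen_sum ideal_gen_smult poly_ring_single)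
    fix \<alpha> assume \<alpha>: "\<alpha> \<in> ?K"
    then have r\<alpha>: "r (toric_weight \<alpha>) \<in> ?K" "toric_weight (r (toric_weight \<alpha>)) = toric_weight \<alpha>"
      using r by auto
    obtain M where M: "set_mset M \<subseteq> B" "\<alpha> = sum_mset (image_mset var_exp M)"
      using monom_of_mset[OF keysB[OF \<alpha>]] .
    obtain N where N: "set_mset N \<subseteq> B" "r (toric_weight \<alpha>) = sum_mset (image_mset var_exp N)"
      using monom_of_mset[OF keysB[OF r\<alpha>(1)]] .
    have "sum_mset N = sum_mset M"
      using r\<alpha>(2) unfolding N(2) unfolding M(2) toric_weight_sum_mset .
    then have "exchange_equiv B M N" using equiv M(1) N(1) by simp
    from exchange_equiv_binomial[OF this]
    show "mono \<alpha> - mono (r (toric_weight \<alpha>)) \<in> ideal_gen (poly_ring B) (sym_exchange_binomials B)"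
      unfolding N(2) unfolding M(2) .
  qed simp
  finally show "P \<in> ideal_gen (poly_ring B) (sym_exchange_binomials B)" .
next
  fix P :: "('v monom, 'k) mpoly"
  assume "P \<in> ideal_gen (poly_ring B) (sym_exchange_binomials B)"
  then obtain F c where F: "F \<subseteq> sym_exchange_binomials B" "\<forall>f\<in>F. c f \<in> poly_ring B"
    "P = (\<Sum>f\<in>F. c f * f)" unfolding ideal_gen_def by blast
  have "c f * f \<in> poly_ring B \<and> toric_map (c f * f) = 0" if fF: "f \<in> F" for f
  proof -
    obtain u v u' v' where f: "f = mono (var_exp u + var_exp v) - mono (var_exp u' + var_exp v')"
      and ex: "sym_exchange B u v u' v'"
      using fF F(1) unfolding sym_exchange_binomials_eq by blast
    have pair: "mono (var_exp a + var_exp b) \<in> poly_ring B" if "a \<in> B" "b \<in> B" for a b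
      unfolding mono_def
      by (rule poly_ring_single) (use that Poly_Mapping.keys_add[of "var_exp a" "var_exp b"] in
        \<open>auto simp: keys_var_exp\<close>)
    have "u \<in> B" "v \<in> B" "u' \<in> B" "v' \<in> B" using ex by (auto simp: sym_exchange_def)
    then have "f \<in> poly_ring B"
      using poly_ring_add[OF pair poly_ring_uminus[OF pair], of u v u' v'] unfolding f by simp
    moreover have "sum_mset ({#} + {#u, v#}) = sum_mset ({#} + {#u', v'#})"
      by (rule exchange_equiv_sum_mset[OF exchange_equiv.step[OF _ ex]]) simp
    then have "toric_weight (var_exp u + var_exp v) = toric_weight (var_exp u' + var_exp v')"
      by (simp add: toric_weight_add toric_weight_var_exp)
    ultimately show ?thesis
      using poly_ring_mult F(2) fF toric_map_mult_binomial unfolding f by blast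
  qed
  then show "P \<in> toric_ideal B"
    unfolding toric_ideal_def F(3) by (auto simp: toric_map_sum intro: poly_ring_sum)
qed

section \<open>Powers of the edge ideal\<close>

text \<open>Every exponent of \<open>c f * f\<close> is an exponent of \<open>c f\<close> plus one
  of \<open>f\<close>, and cancellation only removes exponents. A property stable under adding
  exponents therefore passes from the generators to the whole ideal.\<close>

lemma ideal_gen_keys:
  assumes "p \<in> ideal_gen R S" "m \<in> Poly_Mapping.keys p"
    and gens: "\<And>s a. s \<in> S \<Longrightarrow> a \<in> Poly_Mapping.keys s \<Longrightarrow> Q a"
    and up: "\<And>a b. Q a \<Longrightarrow> Q (b + a)"
  shows "Q m"
proof -
  obtain F c where F: "F \<subseteq> S" "p = (\<Sum>f\<in>F. c f * f)"
    using assms(1) unfolding ideal_gen_def by blast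
  obtain f where f: "f \<in> F" "m \<in> Poly_Mapping.keys (c f * f)"
    using assms(2) Poly_Mapping.keys_sum[of "\<lambda>f. c f * f" F] unfolding F(2) by blast
  obtain a b where "b \<in> Poly_Mapping.keys (c f)" "a \<in> Poly_Mapping.keys f" "m = b + a"
    using f(2) keys_mult[of "c f" f] by blast
  then show ?thesis using gens up f(1) F(1) by blast
qed

definition edge_monoms :: "(nat \<Rightarrow> nat \<Rightarrow> bool) \<Rightarrow> nat monom set" where
  "edge_monoms E = {var_exp i + var_exp j | i j. E i j}"

text \<open>Describes the monomials of the \<open>q\<close>-th power of the edge ideal without
  coefficients; \<open>b\<close> is the cofactor of a product of \<open>q\<close> edges.\<close>

definition edge_multiple :: "(nat \<Rightarrow> nat \<Rightarrow> bool) \<Rightarrow> nat \<Rightarrow> nat monom \<Rightarrow> bool" where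
  "edge_multiple E q a \<longleftrightarrow> (\<exists>M b. set_mset M \<subseteq> edge_monoms E \<and> size M = q \<and> a = b + sum_mset M)"

lemma edge_multiple_up: "edge_multiple E q a \<Longrightarrow> edge_multiple E q (b + a)"
  unfolding edge_multiple_def by (metis add.assoc)

lemma edge_ideal_keys:
  assumes "p \<in> (edge_ideal n E :: (nat, 'k::field) mpoly set)" "m \<in> Poly_Mapping.keys p"
  shows "edge_multiple E 1 m"
  using assms(1) unfolding edge_ideal_def
proof (rule ideal_gen_keys[where Q = "edge_multiple E 1", OF _ assms(2)])
  fix s :: "(nat, 'k) mpoly" and a
  assume "s \<in> {mono (var_exp i + var_exp j) | i j. E i j}" "a \<in> Poly_Mapping.keys s"
  then have "a \<in> edge_monoms E" unfolding mono_def edge_monoms_def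
    by (smt (verit, ccfv_threshold) keys_single mem_Collect_eq singletonD empty_iff)
  then show "edge_multiple E 1 a"
    unfolding edge_multiple_def by (intro exI[of _ "{#a#}"] exI[of _ 0]) auto
qed (rule edge_multiple_up)

lemma prod_list_edge_ideal_keys:
  assumes "set ps \<subseteq> (edge_ideal n E :: (nat, 'k::field) mpoly set)" "m \<in> Poly_Mapping.keys (prod_list ps)"
  shows "edge_multiple E (length ps) m"
  using assms
proof (induction ps arbitrary: m)
  case Nil
  then show ?case unfolding edge_multiple_def by (intro exI[of _ "{#}"] exI[of _ m]) auto
next
  case (Cons p ps)
  obtain a b where ab: "a \<in> Poly_Mapping.keys p" "b \<in> Poly_Mapping.keys (prod_list ps)" "m = a + b"
    using Cons.prems(2) keys_mult[of p "prod_list ps"] by auto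
  have "edge_multiple E 1 a" using edge_ideal_keys[of p n E a] ab(1) Cons.prems(1) by auto
  then obtain M b' where M: "set_mset M \<subseteq> edge_monoms E" "size M = 1" "a = b' + sum_mset M"
    unfolding edge_multiple_def by blast
  have "edge_multiple E (length ps) b" using Cons.IH ab(2) Cons.prems(1) by auto
  then obtain N b'' where N: "set_mset N \<subseteq> edge_monoms E" "size N = length ps" "b = b'' + sum_mset N"
    unfolding edge_multiple_def by blast
  show ?case
    unfolding edge_multiple_def
    by (intro exI[of _ "M + N"] exI[of _ "b' + b''"]) (use M N ab(3) in \<open>auto simp: ac_simps\<close>)
qed

lemma edge_ideal_pow_keys:
  assumes "p \<in> ideal_pow (poly_ring V) (edge_ideal n E :: (nat, 'k::field) mpoly set) q"
    "m \<in> Poly_Mapping.keys p"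
  shows "edge_multiple E q m"
  using assms(1) unfolding ideal_pow_def
proof (rule ideal_gen_keys[where Q = "edge_multiple E q", OF _ assms(2)])
  fix s :: "(nat, 'k) mpoly" and a
  assume "s \<in> {prod_list ps |ps. length ps = q \<and> set ps \<subseteq> edge_ideal n E}" "a \<in> Poly_Mapping.keys s"
  then show "edge_multiple E q a" using prod_list_edge_ideal_keys by blast
qed (rule edge_multiple_up)

lemma mono_in_edge_ideal_pow:
  assumes "set_mset M \<subseteq> edge_monoms E"
  shows "(mono (sum_mset M) :: (nat, 'k::field) mpoly)
    \<in> ideal_pow (poly_ring V) (edge_ideal n E) (size M)"
proof -
  obtain es where es: "mset es = M" by (metis ex_mset)
  define ps where "ps = (map mono es :: (nat, 'k) mpoly list)"
  have "prod_list ps = mono (sum_mset M)"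
    unfolding ps_def es[symmetric]
    by (induction es) (simp_all add: mono_def mult_single flip: single_one)
  moreover have "set ps \<subseteq> edge_ideal n E"
  proof
    fix p assume "p \<in> set ps"
    then obtain e where e: "e \<in># M" "p = mono e" using es by (auto simp: ps_def)
    then obtain i j where "e = var_exp i + var_exp j" "E i j"
      using assms unfolding edge_monoms_def by blast
    then show "p \<in> edge_ideal n E"
      unfolding e(2) edge_ideal_def by (intro ideal_gen_base) blast
  qed
  moreover have "length ps = size M" using es by (auto simp: ps_def)
  ultimately show ?thesis
    unfolding ideal_pow_def by (intro ideal_gen_base CollectI exI[of _ ps]) simp
qed

section \<open>Identification of the minimal generators with the degree vectors of maximum
  matchings\<close>

theorem theorem5p2:
  fixes n :: nat and E :: "nat \<Rightarrow> nat \<Rightarrow> bool" and c :: "nat \<Rightarrow> nat"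
    and K :: "'k::field itself"
  assumes "simple_graph n E"
    and "no_isolated n E"
    and "\<forall>i<n. c i > 0"
    and "delta_c K n E c = 2"
  shows "(toric_ideal (Bset K n E c) :: (nat monom, 'k) mpoly set) =
         ideal_gen (poly_ring (Bset K n E c)) (sym_exchange_binomials (Bset K n E c))"
proof -
  let ?tdeg = "\<lambda>a :: nat monom. \<Sum>i<n. Poly_Mapping.lookup a i"
  have tdeg_add: "?tdeg (a + b) = ?tdeg a + ?tdeg b" for a b
    by (simp add: lookup_add sum.distrib)
  have edge: "\<exists>i\<in>{0..<n}. \<exists>j\<in>{0..<n}. i \<noteq> j \<and> e = var_exp i + var_exp j" if "e \<in> edge_monoms E" for e
    using that assms(1) unfolding edge_monoms_def simple_graph_def by fastforce
  have tdeg_edge: "?tdeg e = 2" if "e \<in> edge_monoms E" for e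
    using edge[OF that] by (auto simp: tdeg_add lookup_var_exp)
  have tdeg_sum: "?tdeg (sum_mset M) = 2 * size M" if "set_mset M \<subseteq> edge_monoms E" for M
    using that by (induction M) (simp_all add: tdeg_add tdeg_edge del: One_nat_def)
  have edge_outside: "deg_at M i = 0"
    if "set_mset M \<subseteq> edge_monoms E" "\<not> i < n" for M i
    using deg_at_outside[of M "{0..<n}" i] edge that by auto
  have sum_bounded: "sum_mset M \<in> bounded_monos K n E c (size M)"
    if M: "set_mset M \<subseteq> edge_monoms E" and "\<forall>i<n. Poly_Mapping.lookup (sum_mset M) i \<le> c i" for M
    using that mono_in_edge_ideal_pow[OF M, where 'k = 'k] edge_outside[OF M]
    unfolding bounded_monos_def by (auto simp: in_keys_iff intro: ccontr)
  \<comment> \<open>A bounded monomial of the power is divisible by a product of \<open>q\<close>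
    edges, and this divisor inherits the bound.\<close>
  have bounded_edges: "\<exists>M. set_mset M \<subseteq> edge_monoms E \<and> size M = q \<and>
      mdvd (sum_mset M) a \<and> sum_mset M \<in> bounded_monos K n E c q \<and> 2 * q \<le> ?tdeg a"
    if a: "a \<in> bounded_monos K n E c q" for a q
  proof -
    have "edge_multiple E q a"
      using a edge_ideal_pow_keys[of "mono a :: (nat, 'k) mpoly" "{0..<n}" n E q a]
      unfolding bounded_monos_def by (auto simp: mono_def)
    then obtain M b where M: "set_mset M \<subseteq> edge_monoms E" "size M = q" "a = b + sum_mset M"
      unfolding edge_multiple_def by blast
    have le: "Poly_Mapping.lookup (sum_mset M) i \<le> Poly_Mapping.lookup a i" for i
      using M(3) by (simp add: lookup_add)
    have "\<forall>i<n. Poly_Mapping.lookup (sum_mset M) i \<le> c i"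
      using a le order_trans unfolding bounded_monos_def by blast
    then have "sum_mset M \<in> bounded_monos K n E c q" using sum_bounded[OF M(1)] M(2) by simp
    moreover have "2 * q \<le> ?tdeg a" using tdeg_sum[OF M(1)] M(2,3) tdeg_add by simp
    ultimately show ?thesis using M le unfolding mdvd_def by blast
  qed
  have no_three: "bounded_monos K n E c 3 = {}"
  proof (rule ccontr)
    assume ne: "bounded_monos K n E c 3 \<noteq> {}"
    \<comment> \<open>Comparing degrees gives 2q \<le> (sum of the c i). The admissible
      \<open>q\<close> are thus bounded, and \<open>GREATEST\<close> really is an upper bound for
      them.\<close>
    have "q \<le> (\<Sum>i<n. c i)" if q: "bounded_monos K n E c q \<noteq> {}" for q
    proof -
      obtain a where a: "a \<in> bounded_monos K n E c q" using q by blast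
      have "?tdeg a \<le> (\<Sum>i<n. c i)" using a unfolding bounded_monos_def by (intro sum_mono) auto
      then show ?thesis using bounded_edges[OF a] by auto
    qed
    then have "3 \<le> delta_c K n E c"
      unfolding delta_c_def using Greatest_le_nat[of "\<lambda>q. bounded_monos K n E c q \<noteq> {}" 3, OF ne] by blast
    then show False using assms(4) by simp
  qed
  interpret bounded_matchings "{0..<n}" "edge_monoms E" c 2
  proof
    fix M assume M: "set_mset M \<subseteq> edge_monoms E" "size M = Suc 2"
    show "\<exists>i. c i < deg_at M i"
    proof (rule ccontr)
      assume "\<nexists>i. c i < deg_at M i"
      then have "\<forall>i<n. Poly_Mapping.lookup (sum_mset M) i \<le> c i" by (simp add: not_less)
      from sum_bounded[OF M(1) this] show False using M(2) no_three by (simp add: eval_nat_numeral)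
    qed
  qed (use edge in auto)
  have B: "Bset K n E c = bases"
  proof (intro equalityI subsetI)
    fix a assume "a \<in> Bset K n E c"
    then have a: "a \<in> bounded_monos K n E c 2"
      "\<And>b. b \<in> bounded_monos K n E c 2 \<Longrightarrow> mdvd b a \<Longrightarrow> b = a"
      unfolding Bset_def assms(4) by (simp_all add: Let_def)
    obtain M where M: "set_mset M \<subseteq> edge_monoms E" "size M = 2" "mdvd (sum_mset M) a"
      "sum_mset M \<in> bounded_monos K n E c 2"
      using bounded_edges[OF a(1)] by blast
    have "sum_mset M = a" using a(2) M by blast
    moreover have "deg_at M i \<le> c i" for i
      using M(4) edge_outside[OF M(1), of i] unfolding bounded_monos_def by (cases "i < n") auto
    ultimately show "a \<in> bases" using M unfolding bases_def matchings_def by blast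
  next
    fix a assume "a \<in> bases"
    then obtain M where M: "a = sum_mset M" "set_mset M \<subseteq> edge_monoms E" "size M = 2"
      "\<forall>i. deg_at M i \<le> c i" unfolding bases_def matchings_def by blast
    have "a \<in> bounded_monos K n E c 2" using sum_bounded[OF M(2)] M by simp
    \<comment> \<open>A proper divisor of \<open>a\<close> has degree below 4, whereas every
      monomial in the bounded square has degree at least 4.\<close>
    moreover have "b = a" if b: "b \<in> bounded_monos K n E c 2" "mdvd b a" for b
    proof (rule ccontr)
      assume "b \<noteq> a"
      then obtain i where "Poly_Mapping.lookup b i \<noteq> Poly_Mapping.lookup a i"
        by (metis poly_mapping_eqI)
      then have lt: "Poly_Mapping.lookup b i < Poly_Mapping.lookup a i"
        using b(2) unfolding mdvd_def by (simp add: le_neq_implies_less)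
      then have "i < n" using edge_outside[OF M(2), of i] M(1) by fastforce
      then have "?tdeg b < ?tdeg a"
        using lt b(2) unfolding mdvd_def by (intro sum_strict_mono_ex1) auto
      then show False using bounded_edges[OF b(1)] tdeg_sum[OF M(2)] M(1,3) by auto
    qed
    ultimately show "a \<in> Bset K n E c" unfolding Bset_def assms(4) by (simp add: Let_def)
  qed
  \<comment> \<open>All bases have degree 4, so equal sums force the equal sizes that
    \<open>equiv_of_equal_sums\<close> requires.\<close>
  have base_deg: "?tdeg (sum_mset M) = 4 * size M" if "set_mset M \<subseteq> bases" for M
    using that
  proof (induction M)
    case (add a M)
    then obtain L where "a = sum_mset L" "set_mset L \<subseteq> edge_monoms E" "size L = 2"
      unfolding bases_def matchings_def by auto
    then have "?tdeg a = 4" using tdeg_sum by simp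
    then show ?case using add by (simp add: tdeg_add)
  qed simp
  show ?thesis
    unfolding B
  proof (rule toric_ideal_generated_by_exchanges)
    fix M N assume MN: "set_mset M \<subseteq> bases" "set_mset N \<subseteq> bases" "sum_mset M = sum_mset N"
    then have "4 * size M = 4 * size N" using base_deg by metis
    then show "exchange_equiv bases M N" using equiv_of_equal_sums MN by simp
  qed
qed

end
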